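(* On the group $\mathbb{Z}_2$ of $2$-adic integers, the space of functions of bounded variation and the homogeneous Besov space $\dot{B}^{1,\infty}_{1}$ coincide, $BV(\mathbb{Z}_2)\simeq\dot{B}^{1,\infty}_{1}(\mathbb{Z}_2)$; that is, a function $f\in L^1(\mathbb{Z}_2)$ belongs to $BV(\mathbb{Z}_2)$ if and only if it belongs to $\dot{B}^{1,\infty}_{1}(\mathbb{Z}_2)$, and there exist universal constants $C_1,C_2>0$ such that for all such $f$ $$C_1\|f\|_{\dot{B}^{1,\infty}_{1}}\leq \|f\|_{BV}\leq C_2\|f\|_{\dot{B}^{1,\infty}_{1}}.$$
   Context: $\mathbb{Z}_2=\{x\in\mathbb{Q}_2:\ |x|_2\le 1\}$, where $|\cdot|_2$ is the $2$-adic norm ($|x|_2=2^{-\gamma(x)}$ with $\gamma$ the $2$-adic valuation, $|0|_2=0$). It carries the Haar measure $dx$ normalized so that $\mathbb{Z}_2$ has measure $1$; $|E|$ denotes the measure of $E$. All functions are real-valued. For $f\in L^1(\mathbb{Z}_2)$ and $j\in\mathbb{N}=\{0,1,2,\dots\}$, $S_j(f)$ is the conditional expectation of $f$ with respect to the algebra generated by the cosets of $2^j\mathbb{Z}_2$: $$S_j(f)(x)=\frac{1}{|x+2^j\mathbb{Z}_2|}\int_{x+2^j\mathbb{Z}_2}f(y)\,dy,$$ and the dyadic blocks are $\Delta_j(f)=S_{j+1}(f)-S_j(f)$. The homogeneous Besov (semi)norm is $\|f\|_{\dot{B}^{1,\infty}_{1}}=\sup_{j\in\mathbb{N}}2^{j}\|\Delta_jf\|_{L^1}$,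 and $f\in\dot{B}^{1,\infty}_1(\mathbb{Z}_2)$ means this is finite. $f\in BV(\mathbb{Z}_2)$ means there is a constant $C>0$ with $\int_{\mathbb{Z}_2}|f(x+y)-f(x)|\,dx\le C|y|_2$ for all $y\in\mathbb{Z}_2$; $\|f\|_{BV}$ is the infimum of such constants $C$, i.e. $\|f\|_{BV}=\sup_{y\ne0}|y|_2^{-1}\int_{\mathbb{Z}_2}|f(x+y)-f(x)|\,dx$. *)

theory Defs
  imports "HOL-Probability.Probability"
begin

section \<open>The 2-adic absolute value on the rationals\<close>

definition rat_val2 :: "rat \<Rightarrow> int" where
  "rat_val2 q = int (multiplicity 2 (fst (quotient_of q))) - int (multiplicity 2 (snd (quotient_of q)))"

definition rat_abs2 :: "rat \<Rightarrow> real" where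
  "rat_abs2 q = (if q = 0 then 0 else 2 powi (- rat_val2 q))"

lemma rat_val2_divide:
  assumes "a \<noteq> 0" "b \<noteq> 0"
  shows "rat_val2 (of_int a / of_int b) = int (multiplicity 2 a) - int (multiplicity 2 b)"
proof -
  obtain c d where cd: "quotient_of (of_int a / of_int b) = (c, d)" by force
  have d: "d > 0" using quotient_of_denom_pos[OF cd] .
  have "(of_int a / of_int b :: rat) = of_int c / of_int d" using quotient_of_div[OF cd] .
  then have "(of_int (a * d) :: rat) = of_int (c * b)"
    using assms d by (simp add: field_simps)
  then have eq: "a * d = c * b" by (simp only: of_int_eq_iff)
  with assms d have c: "c \<noteq> 0" by auto
  have "multiplicity 2 (a * d) = multiplicity 2 a + multiplicity 2 d"
    using assms d by (intro prime_elem_multiplicity_mult_distrib) auto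
  moreover have "multiplicity 2 (c * b) = multiplicity 2 c + multiplicity 2 b"
    using assms c by (intro prime_elem_multiplicity_mult_distrib) auto
  ultimately show ?thesis using eq by (simp add: rat_val2_def cd)
qed

lemma rat_abs2_divide:
  assumes "a \<noteq> 0" "b \<noteq> 0"
  shows "rat_abs2 (of_int a / of_int b) = 2 ^ multiplicity 2 b / 2 ^ multiplicity 2 a"
  using assms by (simp add: rat_abs2_def rat_val2_divide power_int_diff)

lemma rat_abs2_nonneg [simp]: "0 \<le> rat_abs2 x"
  by (simp add: rat_abs2_def)

lemma rat_abs2_eq_0 [simp]: "rat_abs2 x = 0 \<longleftrightarrow> x = 0"
  by (simp add: rat_abs2_def)

lemma rat_abs2_0 [simp]: "rat_abs2 0 = 0"
  by simp

lemma multiplicity_minus2: "multiplicity 2 (- a :: int) = multiplicity 2 a"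
  by (rule multiplicity_cong) simp

lemma rat_abs2_minus [simp]: "rat_abs2 (- x) = rat_abs2 x"
  by (cases "x = 0")
    (auto simp: rat_abs2_def rat_val2_def rat_uminus_code Let_def multiplicity_minus2
      split: prod.splits)

lemma rat_abs2_diff_commute: "rat_abs2 (x - y) = rat_abs2 (y - x)"
  by (metis minus_diff_eq rat_abs2_minus)

lemma rat_common_denominator:
  fixes x y :: rat
  obtains a b d where "x = of_int a / (of_int d :: rat)" "y = of_int b / of_int d" "d \<noteq> (0::int)"
proof -
  obtain a c where x: "quotient_of x = (a, c)" by force
  obtain b e where y: "quotient_of y = (b, e)" by force
  have "c > 0" "e > 0" using quotient_of_denom_pos[OF x] quotient_of_denom_pos[OF y] by auto
  then have "x = of_int (a * e) / of_int (c * e)" "y = of_int (b * c) / of_int (c * e)" "c * e \<noteq> 0"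
    using quotient_of_div[OF x] quotient_of_div[OF y] by auto
  then show ?thesis using that by blast
qed

lemma rat_abs2_mult [simp]: "rat_abs2 (x * y) = rat_abs2 x * rat_abs2 y"
proof (cases "x = 0 \<or> y = 0")
  case False
  obtain a b d where *: "x = of_int a / (of_int d :: rat)" "y = of_int b / of_int d" "d \<noteq> (0::int)"
    using rat_common_denominator .
  with False have nz: "a \<noteq> 0" "b \<noteq> 0" by auto
  have "rat_abs2 (of_int (a * b) / of_int (d * d))
    = 2 ^ multiplicity 2 (d * d) / 2 ^ multiplicity 2 (a * b)"
    using * nz by (intro rat_abs2_divide) auto
  also have "multiplicity 2 (d * d) = multiplicity 2 d + multiplicity 2 d"
    using * by (intro prime_elem_multiplicity_mult_distrib) auto
  also have "multiplicity 2 (a * b) = multiplicity 2 a + multiplicity 2 b"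
    using nz by (intro prime_elem_multiplicity_mult_distrib) auto
  finally show ?thesis
    using * nz by (simp add: rat_abs2_divide power_add)
qed auto

lemma rat_abs2_1 [simp]: "rat_abs2 1 = 1"
  by (simp add: rat_abs2_def rat_val2_def)

lemma rat_abs2_inverse [simp]: "rat_abs2 (inverse x) = inverse (rat_abs2 x)"
proof (cases "x = 0")
  case False
  then have "rat_abs2 x * rat_abs2 (inverse x) = 1"
    by (metis rat_abs2_1 rat_abs2_mult right_inverse)
  then show ?thesis by (simp add: inverse_unique)
qed auto

lemma rat_abs2_ultra: "rat_abs2 (x + y) \<le> max (rat_abs2 x) (rat_abs2 y)"
proof (cases "x = 0 \<or> y = 0 \<or> x + y = 0")
  case False
  obtain a b d where *: "x = of_int a / (of_int d :: rat)" "y = of_int b / of_int d" "d \<noteq> (0::int)"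
    using rat_common_denominator .
  with False have nz: "a \<noteq> 0" "b \<noteq> 0" by auto
  have eq: "x + y = of_int (a + b) / of_int d" using * by (simp add: add_divide_distrib)
  with False have nz': "a + b \<noteq> 0" by auto
  let ?m = "min (multiplicity 2 a) (multiplicity 2 b)"
  have "2 ^ ?m dvd a + b" by (intro dvd_add multiplicity_dvd') auto
  then have "?m \<le> multiplicity 2 (a + b)" using nz' by (intro multiplicity_geI) auto
  then have "(2::real) ^ ?m \<le> 2 ^ multiplicity 2 (a + b)" by (intro power_increasing) auto
  then have "rat_abs2 (x + y) \<le> 2 ^ multiplicity 2 d / 2 ^ ?m"
    unfolding eq using * nz' by (simp add: rat_abs2_divide frac_le del: of_int_add)
  also have "\<dots> \<le> max (rat_abs2 x) (rat_abs2 y)"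
    using * nz by (auto simp: rat_abs2_divide min_def)
  finally show ?thesis .
qed (auto simp: le_max_iff_disj)

lemma rat_abs2_triangle: "rat_abs2 (x + y) \<le> rat_abs2 x + rat_abs2 y"
  using rat_abs2_ultra[of x y] rat_abs2_nonneg[of x] rat_abs2_nonneg[of y] by linarith

lemma rat_abs2_triangle_diff: "rat_abs2 (x - y) \<le> rat_abs2 (x - z) + rat_abs2 (z - y)"
  using rat_abs2_triangle[of "x - z" "z - y"] by simp

lemma rat_abs2_diff_ineq: "\<bar>rat_abs2 x - rat_abs2 y\<bar> \<le> rat_abs2 (x - y)"
  using rat_abs2_triangle[of "x - y" y] rat_abs2_triangle[of "y - x" x] rat_abs2_diff_commute[of x y]
  by simp

lemma rat_abs2_power2: "rat_abs2 (2 ^ n) = 1 / 2 ^ n"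
  using rat_abs2_divide[of "2 ^ n" 1] by (simp add: multiplicity_same_power)

lemma rat_abs2_of_int_le_iff: "rat_abs2 (of_int a) \<le> 1 / 2 ^ n \<longleftrightarrow> 2 ^ n dvd a"
proof (cases "a = 0")
  case False
  then have "rat_abs2 (of_int a) = 1 / 2 ^ multiplicity 2 a"
    using rat_abs2_divide[of a 1] by simp
  then have "rat_abs2 (of_int a) \<le> 1 / 2 ^ n \<longleftrightarrow> (2::real) ^ n \<le> 2 ^ multiplicity 2 a"
    by (simp only: divide_le_cancel) (simp add: divide_simps)
  then show ?thesis using False by (simp add: power_dvd_iff_le_multiplicity)
qed auto

section \<open>The field of 2-adic numbers, as the completion of the rationals\<close>

definition cauchy2 :: "(nat \<Rightarrow> rat) \<Rightarrow> bool" where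
  "cauchy2 X \<longleftrightarrow> (\<forall>e>0. \<exists>N. \<forall>m\<ge>N. \<forall>n\<ge>N. rat_abs2 (X m - X n) < e)"

definition null2 :: "(nat \<Rightarrow> rat) \<Rightarrow> bool" where
  "null2 X \<longleftrightarrow> (\<lambda>n. rat_abs2 (X n)) \<longlonglongrightarrow> 0"

lemma null2_le:
  assumes "null2 X" "null2 Y" "\<And>n. rat_abs2 (Z n) \<le> rat_abs2 (X n) + rat_abs2 (Y n)"
  shows "null2 Z"
proof -
  have "(\<lambda>n. rat_abs2 (X n) + rat_abs2 (Y n)) \<longlonglongrightarrow> 0"
    using tendsto_add[OF assms(1,2)[unfolded null2_def]] by simp
  then show ?thesis unfolding null2_def
    by (rule tendsto_sandwich[rotated -1]) (auto simp: assms(3))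
qed

lemma null2_zero [simp]: "null2 (\<lambda>_. 0)"
  by (simp add: null2_def)

lemma null2_minus: "null2 X \<Longrightarrow> null2 (\<lambda>n. - X n)"
  by (simp add: null2_def)

lemma null2_add: "null2 X \<Longrightarrow> null2 Y \<Longrightarrow> null2 (\<lambda>n. X n + Y n)"
  by (erule (1) null2_le) (rule rat_abs2_triangle)

lemma null2_diff_commute: "null2 (\<lambda>n. X n - Y n) \<Longrightarrow> null2 (\<lambda>n. Y n - X n)"
  using null2_minus by fastforce

lemma cauchy2_const [simp]: "cauchy2 (\<lambda>_. q)"
  by (auto simp: cauchy2_def)

lemma cauchy2_le:
  assumes "cauchy2 X" "cauchy2 Y"
    "\<And>m n. rat_abs2 (Z m - Z n) \<le> rat_abs2 (X m - X n) + rat_abs2 (Y m - Y n)"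
  shows "cauchy2 Z"
  unfolding cauchy2_def
proof (intro allI impI)
  fix e :: real assume "e > 0"
  then have e: "e / 2 > 0" by simp
  obtain N where N: "\<forall>m\<ge>N. \<forall>n\<ge>N. rat_abs2 (X m - X n) < e / 2"
    using assms(1) e unfolding cauchy2_def by blast
  obtain M where M: "\<forall>m\<ge>M. \<forall>n\<ge>M. rat_abs2 (Y m - Y n) < e / 2"
    using assms(2) e unfolding cauchy2_def by blast
  have "rat_abs2 (Z m - Z n) < e" if "m \<ge> max M N" "n \<ge> max M N" for m n
  proof -
    have "rat_abs2 (X m - X n) < e / 2" "rat_abs2 (Y m - Y n) < e / 2" using N M that by auto
    then show ?thesis using assms(3)[of m n] by linarith
  qed
  then show "\<exists>N. \<forall>m\<ge>N. \<forall>n\<ge>N. rat_abs2 (Z m - Z n) < e" by blast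
qed

lemma cauchy2_add: "cauchy2 X \<Longrightarrow> cauchy2 Y \<Longrightarrow> cauchy2 (\<lambda>n. X n + Y n)"
  by (erule (1) cauchy2_le) (simp only: add_diff_add rat_abs2_triangle)

lemma cauchy2_minus: "cauchy2 X \<Longrightarrow> cauchy2 (\<lambda>n. - X n)"
  by (erule cauchy2_le[of _ "\<lambda>_. 0"]) (auto simp: rat_abs2_diff_commute)

lemma cauchy2_diff: "cauchy2 X \<Longrightarrow> cauchy2 Y \<Longrightarrow> cauchy2 (\<lambda>n. X n - Y n)"
  using cauchy2_add[OF _ cauchy2_minus] by fastforce

lemma cauchy2_abs_convergent:
  assumes "cauchy2 X"
  shows "convergent (\<lambda>n. rat_abs2 (X n))"
proof -
  have "Cauchy (\<lambda>n. rat_abs2 (X n))"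
    unfolding Cauchy_def dist_real_def
    using assms rat_abs2_diff_ineq unfolding cauchy2_def by (meson le_less_trans)
  then show ?thesis by (rule Cauchy_convergent)
qed

lemma cauchy2_lim: "cauchy2 X \<Longrightarrow> (\<lambda>n. rat_abs2 (X n)) \<longlonglongrightarrow> lim (\<lambda>n. rat_abs2 (X n))"
  using cauchy2_abs_convergent convergent_LIMSEQ_iff by blast

lemma cauchy2_bounded:
  assumes "cauchy2 X"
  obtains B where "B > 0" "\<And>n. rat_abs2 (X n) \<le> B"
proof -
  have "Bseq (\<lambda>n. rat_abs2 (X n))" using cauchy2_abs_convergent[OF assms] by (rule convergent_imp_Bseq)
  then show ?thesis using that unfolding Bseq_def by auto
qed

lemma cauchy2_scale:
  assumes "cauchy2 X" "B > 0"
  shows "\<And>e. e > 0 \<Longrightarrow> \<exists>N. \<forall>m\<ge>N. \<forall>n\<ge>N. B * rat_abs2 (X m - X n) < e"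
proof -
  fix e :: real assume "e > 0"
  then have "e / B > 0" using assms by simp
  then obtain N where "\<forall>m\<ge>N. \<forall>n\<ge>N. rat_abs2 (X m - X n) < e / B"
    using assms(1) unfolding cauchy2_def by blast
  then show "\<exists>N. \<forall>m\<ge>N. \<forall>n\<ge>N. B * rat_abs2 (X m - X n) < e"
    using assms(2) by (auto simp: field_simps)
qed

lemma cauchy2_mult:
  assumes X: "cauchy2 X" and Y: "cauchy2 Y"
  shows "cauchy2 (\<lambda>n. X n * Y n)"
  unfolding cauchy2_def
proof (intro allI impI)
  fix e :: real assume "e > 0"
  then have e: "e / 2 > 0" by simp
  obtain A where A: "A > 0" "\<And>n. rat_abs2 (X n) \<le> A" using cauchy2_bounded[OF X] by blast
  obtain B where B: "B > 0" "\<And>n. rat_abs2 (Y n) \<le> B" using cauchy2_bounded[OF Y] by blast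
  obtain N where N: "\<forall>m\<ge>N. \<forall>n\<ge>N. B * rat_abs2 (X m - X n) < e / 2"
    using cauchy2_scale[OF X B(1) e] by blast
  obtain M where M: "\<forall>m\<ge>M. \<forall>n\<ge>M. A * rat_abs2 (Y m - Y n) < e / 2"
    using cauchy2_scale[OF Y A(1) e] by blast
  have "rat_abs2 (X m * Y m - X n * Y n) < e" if "m \<ge> max M N" "n \<ge> max M N" for m n
  proof -
    have "X m * Y m - X n * Y n = X m * (Y m - Y n) + (X m - X n) * Y n" by (simp add: algebra_simps)
    then have "rat_abs2 (X m * Y m - X n * Y n)
        \<le> rat_abs2 (X m) * rat_abs2 (Y m - Y n) + rat_abs2 (X m - X n) * rat_abs2 (Y n)"
      using rat_abs2_triangle by (metis rat_abs2_mult)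
    also have "\<dots> \<le> A * rat_abs2 (Y m - Y n) + rat_abs2 (X m - X n) * B"
      by (intro add_mono mult_mono A B) (use A in auto)
    also have "\<dots> < e / 2 + e / 2" using N M that by (intro add_strict_mono) (auto simp: mult.commute)
    finally show ?thesis by simp
  qed
  then show "\<exists>N. \<forall>m\<ge>N. \<forall>n\<ge>N. rat_abs2 (X m * Y m - X n * Y n) < e" by blast
qed

lemma null2_mult:
  assumes X: "cauchy2 X" and Y: "null2 Y"
  shows "null2 (\<lambda>n. X n * Y n)"
  using tendsto_mult[OF cauchy2_lim[OF X] Y[unfolded null2_def]] by (simp add: null2_def)

definition q2rel :: "(nat \<Rightarrow> rat) \<Rightarrow> (nat \<Rightarrow> rat) \<Rightarrow> bool" where
  "q2rel X Y \<longleftrightarrow> cauchy2 X \<and> cauchy2 Y \<and> null2 (\<lambda>n. X n - Y n)"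

lemma part_equivp_q2rel: "part_equivp q2rel"
proof (rule part_equivpI)
  show "\<exists>X. q2rel X X" by (rule exI[of _ "\<lambda>_. 0"]) (simp add: q2rel_def)
  show "symp q2rel" by (rule sympI) (auto simp: q2rel_def intro: null2_diff_commute)
  show "transp q2rel"
    by (rule transpI) (auto simp: q2rel_def dest: null2_add)
qed

quotient_type q2 = "nat \<Rightarrow> rat" / partial: q2rel
  morphisms rep_q2 Q2
  by (rule part_equivp_q2rel)

lemma cr_q2_eq: "pcr_q2 = (\<lambda>x y. cauchy2 x \<and> Q2 x = y)"
  unfolding q2.pcr_cr_eq cr_q2_def q2rel_def by auto

lemma Q2_cases [case_names Q2, cases type: q2]:
  obtains X where "cauchy2 X" "x = Q2 X"
  by (metis Quotient3_q2 Quotient3_def q2rel_def)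

lemma eq_Q2: "cauchy2 X \<Longrightarrow> cauchy2 Y \<Longrightarrow> Q2 X = Q2 Y \<longleftrightarrow> null2 (\<lambda>n. X n - Y n)"
  using q2.rel_eq_transfer
  unfolding q2.pcr_cr_eq cr_q2_def rel_fun_def q2rel_def by simp

lemma Domainp_pcr_q2 [transfer_domain_rule]: "Domainp pcr_q2 = cauchy2"
  by (simp add: q2.domain_eq q2rel_def)

lemma cauchy2_eventually_const:
  assumes X: "cauchy2 X" and nz: "\<not> null2 X"
  obtains c N where "c > 0" "\<And>n. n \<ge> N \<Longrightarrow> rat_abs2 (X n) = c"
proof -
  define l where "l = lim (\<lambda>n. rat_abs2 (X n))"
  have l: "(\<lambda>n. rat_abs2 (X n)) \<longlonglongrightarrow> l" unfolding l_def by (rule cauchy2_lim[OF X])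
  have "l \<ge> 0" using l by (rule LIMSEQ_le_const) auto
  moreover have "l \<noteq> 0" using l nz by (auto simp: null2_def)
  ultimately have l0: "l / 2 > 0" by simp
  from order_tendstoD(1)[OF l, of "l / 2"] l0
  obtain M where M: "\<And>n. n \<ge> M \<Longrightarrow> rat_abs2 (X n) > l / 2"
    by (auto simp: eventually_sequentially)
  obtain K where K: "\<forall>m\<ge>K. \<forall>n\<ge>K. rat_abs2 (X m - X n) < l / 2"
    using X l0 unfolding cauchy2_def by blast
  let ?N = "max M K"
  have le: "rat_abs2 (X m) \<le> rat_abs2 (X n)" if "m \<ge> ?N" "n \<ge> ?N" for m n
  proof -
    have "rat_abs2 (X m) \<le> max (rat_abs2 (X m - X n)) (rat_abs2 (X n))"
      using rat_abs2_ultra[of "X m - X n" "X n"] by simp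
    moreover have "rat_abs2 (X m - X n) < l / 2" "l / 2 < rat_abs2 (X m)" using K M that by auto
    ultimately show ?thesis by linarith
  qed
  have "rat_abs2 (X n) = rat_abs2 (X ?N)" if "n \<ge> ?N" for n
    using le[of n ?N] le[of ?N n] that by simp
  moreover have "rat_abs2 (X ?N) > 0" using M[of ?N] l0 by simp
  ultimately show ?thesis using that by blast
qed

lemma cauchy2_inverse:
  assumes X: "cauchy2 X" and nz: "\<not> null2 X"
  shows "cauchy2 (\<lambda>n. inverse (X n))"
  unfolding cauchy2_def
proof (intro allI impI)
  fix e :: real assume e: "e > 0"
  obtain c N where c: "c > 0" "\<And>n. n \<ge> N \<Longrightarrow> rat_abs2 (X n) = c"
    using cauchy2_eventually_const[OF X nz] by blast
  have "1 / c\<^sup>2 > 0" using c by simp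
  from cauchy2_scale[OF X this e]
  obtain M where M: "\<forall>m\<ge>M. \<forall>n\<ge>M. 1 / c\<^sup>2 * rat_abs2 (X m - X n) < e" by blast
  have "rat_abs2 (inverse (X m) - inverse (X n)) < e" if "m \<ge> max M N" "n \<ge> max M N" for m n
  proof -
    have a: "rat_abs2 (X m) = c" "rat_abs2 (X n) = c" using c that by auto
    then have "X m \<noteq> 0" "X n \<noteq> 0" using c(1) by auto
    then have "inverse (X m) - inverse (X n) = - (inverse (X m) * (X m - X n) * inverse (X n))"
      by (rule inverse_diff_inverse)
    then have "rat_abs2 (inverse (X m) - inverse (X n)) = inverse c * rat_abs2 (X m - X n) * inverse c"
      using a by (simp only: rat_abs2_minus rat_abs2_mult rat_abs2_inverse)
    then have "rat_abs2 (inverse (X m) - inverse (X n)) = 1 / c\<^sup>2 * rat_abs2 (X m - X n)"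
      by (simp add: power2_eq_square divide_inverse)
    then show ?thesis using M that by simp
  qed
  then show "\<exists>N. \<forall>m\<ge>N. \<forall>n\<ge>N. rat_abs2 (inverse (X m) - inverse (X n)) < e" by blast
qed

lemma null2_cong:
  assumes "null2 X" "null2 (\<lambda>n. X n - Y n)" shows "null2 Y"
  using null2_add[OF assms(1) null2_minus[OF assms(2)]] by simp

lemma null2_inverse_diff:
  assumes X: "cauchy2 X" "\<not> null2 X" and Y: "cauchy2 Y" "\<not> null2 Y"
    and d: "null2 (\<lambda>n. X n - Y n)"
  shows "null2 (\<lambda>n. inverse (X n) - inverse (Y n))"
proof -
  have "null2 (\<lambda>n. (inverse (X n) * inverse (Y n)) * (Y n - X n))"
    by (intro null2_mult cauchy2_mult cauchy2_inverse X Y null2_diff_commute[OF d])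
  moreover obtain c N where c: "c > 0" "\<And>n. n \<ge> N \<Longrightarrow> rat_abs2 (X n) = c"
    using cauchy2_eventually_const[OF X] by blast
  moreover obtain c' N' where c': "c' > 0" "\<And>n. n \<ge> N' \<Longrightarrow> rat_abs2 (Y n) = c'"
    using cauchy2_eventually_const[OF Y] by blast
  moreover have "\<forall>\<^sub>F n in sequentially. rat_abs2 ((inverse (X n) * inverse (Y n)) * (Y n - X n))
     = rat_abs2 (inverse (X n) - inverse (Y n))"
    unfolding eventually_sequentially
  proof (intro exI[of _ "max N N'"] allI impI)
    fix n assume "n \<ge> max N N'"
    then have "X n \<noteq> 0" "Y n \<noteq> 0" using c c' by force+
    then show "rat_abs2 ((inverse (X n) * inverse (Y n)) * (Y n - X n))
     = rat_abs2 (inverse (X n) - inverse (Y n))"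
      by (intro arg_cong[where f = rat_abs2]) (simp add: field_simps)
  qed
  ultimately show ?thesis unfolding null2_def using Lim_transform_eventually by fast
qed

instantiation q2 :: field
begin

lift_definition zero_q2 :: q2 is "\<lambda>_. 0" by (simp add: q2rel_def)

lift_definition one_q2 :: q2 is "\<lambda>_. 1" by (simp add: q2rel_def)

lift_definition plus_q2 :: "q2 \<Rightarrow> q2 \<Rightarrow> q2" is "\<lambda>X Y n. X n + Y n"
  by (auto simp: q2rel_def add_diff_add intro: cauchy2_add null2_add)

lift_definition uminus_q2 :: "q2 \<Rightarrow> q2" is "\<lambda>X n. - X n"
  by (auto simp: q2rel_def intro: cauchy2_minus dest: null2_diff_commute)

lift_definition times_q2 :: "q2 \<Rightarrow> q2 \<Rightarrow> q2" is "\<lambda>X Y n. X n * Y n"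
proof -
  fix X X' Y Y' assume *: "q2rel X X'" "q2rel Y Y'"
  have "null2 (\<lambda>n. X n * (Y n - Y' n) + Y' n * (X n - X' n))"
    using * by (intro null2_add null2_mult) (auto simp: q2rel_def)
  then show "q2rel (\<lambda>n. X n * Y n) (\<lambda>n. X' n * Y' n)"
    using * by (auto simp: q2rel_def algebra_simps intro: cauchy2_mult)
qed

lift_definition inverse_q2 :: "q2 \<Rightarrow> q2" is
  "\<lambda>X. if null2 X then (\<lambda>_. 0) else (\<lambda>n. inverse (X n))"
proof -
  fix X Y assume *: "q2rel X Y"
  then have "null2 X \<longleftrightarrow> null2 Y"
    unfolding q2rel_def by (metis null2_cong null2_diff_commute)
  then show "q2rel (if null2 X then (\<lambda>_. 0) else (\<lambda>n. inverse (X n)))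
      (if null2 Y then (\<lambda>_. 0) else (\<lambda>n. inverse (Y n)))"
    using * by (simp add: q2rel_def cauchy2_inverse null2_inverse_diff)
qed

definition minus_q2 :: "q2 \<Rightarrow> q2 \<Rightarrow> q2" where "x - y = x + - y" for x y :: q2

definition divide_q2 :: "q2 \<Rightarrow> q2 \<Rightarrow> q2" where "x div y = x * inverse y" for x y :: q2

lemma add_Q2: "cauchy2 X \<Longrightarrow> cauchy2 Y \<Longrightarrow> Q2 X + Q2 Y = Q2 (\<lambda>n. X n + Y n)"
  using plus_q2.transfer by (simp add: cr_q2_eq rel_fun_def)

lemma minus_Q2: "cauchy2 X \<Longrightarrow> - Q2 X = Q2 (\<lambda>n. - X n)"
  using uminus_q2.transfer by (simp add: cr_q2_eq rel_fun_def)

lemma diff_Q2: "cauchy2 X \<Longrightarrow> cauchy2 Y \<Longrightarrow> Q2 X - Q2 Y = Q2 (\<lambda>n. X n - Y n)"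
  by (simp add: minus_q2_def minus_Q2 add_Q2 cauchy2_minus)

lemma mult_Q2: "cauchy2 X \<Longrightarrow> cauchy2 Y \<Longrightarrow> Q2 X * Q2 Y = Q2 (\<lambda>n. X n * Y n)"
  using times_q2.transfer by (simp add: cr_q2_eq rel_fun_def)

instance
proof
  fix a b c :: q2
  show "a + b = b + a" by transfer (simp add: ac_simps q2rel_def cauchy2_add)
  show "(a + b) + c = a + (b + c)" by transfer (simp add: ac_simps q2rel_def cauchy2_add)
  show "0 + a = a" by transfer (simp add: q2rel_def)
  show "- a + a = 0" by transfer (simp add: q2rel_def)
  show "a - b = a + - b" by (rule minus_q2_def)
  show "(a * b) * c = a * (b * c)" by transfer (simp add: ac_simps q2rel_def cauchy2_mult)
  show "a * b = b * a" by transfer (simp add: ac_simps q2rel_def cauchy2_mult)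
  show "1 * a = a" by transfer (simp add: q2rel_def)
  show "(a + b) * c = a * c + b * c"
    by transfer (simp add: distrib_right q2rel_def cauchy2_add cauchy2_mult)
  show "(0::q2) \<noteq> 1" by transfer (auto simp: q2rel_def null2_def LIMSEQ_const_iff)
  show "a \<noteq> 0 \<Longrightarrow> inverse a * a = 1"
  proof transfer
    fix X assume X: "cauchy2 X" and "\<not> q2rel X (\<lambda>_. 0)"
    then have nz: "\<not> null2 X" by (simp add: q2rel_def)
    obtain c N where c: "c > 0" "\<And>n. n \<ge> N \<Longrightarrow> rat_abs2 (X n) = c"
      using cauchy2_eventually_const[OF X nz] by blast
    have "inverse (X n) * X n - 1 = 0" if "n \<ge> N" for n
    proof -
      have "X n \<noteq> 0" using c(1) c(2)[OF that] by auto
      then show ?thesis by simp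
    qed
    then have "null2 (\<lambda>n. inverse (X n) * X n - 1)"
      unfolding null2_def by (intro tendsto_eventually) (auto simp: eventually_sequentially)
    then show "q2rel (\<lambda>n. (if null2 X then \<lambda>_. 0 else (\<lambda>n. inverse (X n))) n * X n) (\<lambda>_. 1)"
      using nz X cauchy2_mult[OF cauchy2_inverse[OF X nz] X] by (simp add: q2rel_def)
  qed
  show "a div b = a * inverse b" by (rule divide_q2_def)
  show "inverse (0::q2) = 0" by transfer (simp add: q2rel_def)
qed

end

lift_definition q2_abs :: "q2 \<Rightarrow> real" is "\<lambda>X. lim (\<lambda>n. rat_abs2 (X n))"
proof -
  fix X Y assume *: "q2rel X Y"
  have "(\<lambda>n. rat_abs2 (X n) - rat_abs2 (Y n)) \<longlonglongrightarrow> 0"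
    by (rule Lim_null_comparison[of _ "\<lambda>n. rat_abs2 (X n - Y n)"])
      (use * in \<open>auto simp: q2rel_def null2_def rat_abs2_diff_ineq\<close>)
  moreover have "(\<lambda>n. rat_abs2 (X n) - rat_abs2 (Y n)) \<longlonglongrightarrow>
      lim (\<lambda>n. rat_abs2 (X n)) - lim (\<lambda>n. rat_abs2 (Y n))"
    using * by (intro tendsto_diff cauchy2_lim) (auto simp: q2rel_def)
  ultimately show "lim (\<lambda>n. rat_abs2 (X n)) = lim (\<lambda>n. rat_abs2 (Y n))"
    using LIMSEQ_unique by fastforce
qed

lemma q2_abs_Q2: "cauchy2 X \<Longrightarrow> q2_abs (Q2 X) = lim (\<lambda>n. rat_abs2 (X n))"
  using q2_abs.transfer by (simp add: cr_q2_eq rel_fun_def)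

lemma tendsto_q2_abs_Q2: "cauchy2 X \<Longrightarrow> (\<lambda>n. rat_abs2 (X n)) \<longlonglongrightarrow> q2_abs (Q2 X)"
  by (simp add: q2_abs_Q2 cauchy2_lim)

lemma q2_abs_eq_0 [simp]: "q2_abs (x :: q2) = 0 \<longleftrightarrow> x = 0"
proof (cases x)
  case (Q2 X)
  have "x = 0 \<longleftrightarrow> null2 X" using Q2 eq_Q2[of X "\<lambda>_. 0"] by (simp add: zero_q2_def)
  also have "\<dots> \<longleftrightarrow> q2_abs x = 0"
    using tendsto_q2_abs_Q2[OF Q2(1)] Q2(2) LIMSEQ_unique unfolding null2_def by metis
  finally show ?thesis by simp
qed

lemma q2_abs_0 [simp]: "q2_abs (0 :: q2) = 0" by simp

lemma q2_abs_nonneg [simp]: "0 \<le> q2_abs (x :: q2)"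
  by (cases x) (auto intro: LIMSEQ_le_const[OF tendsto_q2_abs_Q2])

lemma q2_abs_ultra: "q2_abs (x + y) \<le> max (q2_abs x) (q2_abs (y :: q2))"
proof (cases x; cases y)
  fix X Y assume *: "cauchy2 X" "x = Q2 X" "cauchy2 Y" "y = Q2 Y"
  have "(\<lambda>n. max (rat_abs2 (X n)) (rat_abs2 (Y n))) \<longlonglongrightarrow> max (q2_abs x) (q2_abs y)"
    using * by (auto intro!: tendsto_max tendsto_q2_abs_Q2)
  moreover have "(\<lambda>n. rat_abs2 (X n + Y n)) \<longlonglongrightarrow> q2_abs (x + y)"
    using * by (auto simp: add_Q2 intro: tendsto_q2_abs_Q2 cauchy2_add)
  ultimately show ?thesis by (rule_tac LIMSEQ_le) (auto intro!: exI[of _ 0] rat_abs2_ultra)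
qed

lemma q2_abs_mult [simp]: "q2_abs (x * y) = q2_abs x * q2_abs (y :: q2)"
proof (cases x; cases y)
  fix X Y assume *: "cauchy2 X" "x = Q2 X" "cauchy2 Y" "y = Q2 Y"
  have "(\<lambda>n. rat_abs2 (X n * Y n)) \<longlonglongrightarrow> q2_abs x * q2_abs y"
    using * by (auto intro!: tendsto_mult tendsto_q2_abs_Q2)
  moreover have "(\<lambda>n. rat_abs2 (X n * Y n)) \<longlonglongrightarrow> q2_abs (x * y)"
    using * tendsto_q2_abs_Q2[OF cauchy2_mult[of X Y]] by (simp add: mult_Q2)
  ultimately show ?thesis using LIMSEQ_unique by blast
qed

lemma q2_abs_minus [simp]: "q2_abs (- x :: q2) = q2_abs x"
  by (cases x) (simp add: minus_Q2 q2_abs_Q2 cauchy2_minus)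

lemma q2_abs_diff_commute: "q2_abs (x - y :: q2) = q2_abs (y - x)"
  by (metis minus_diff_eq q2_abs_minus)

lemma q2_abs_ultra_diff: "q2_abs (x - y) \<le> max (q2_abs x) (q2_abs (y :: q2))"
  using q2_abs_ultra[of x "- y"] by simp

lemma Q2_const_of_nat: "Q2 (\<lambda>_. of_nat n) = of_nat n"
proof (induction n)
  case (Suc n)
  have "Q2 (\<lambda>_. of_nat (Suc n)) = Q2 (\<lambda>_. 1) + Q2 (\<lambda>_. of_nat n)"
    by (subst add_Q2) auto
  then show ?case using Suc by (simp add: one_q2_def)
qed (simp add: zero_q2_def)

lemma Q2_const_of_int: "Q2 (\<lambda>_. of_int z) = of_int z"
proof (cases z rule: int_cases2)
  case (nonpos n)
  then show ?thesis using Q2_const_of_nat[of n] minus_Q2[of "\<lambda>_. of_nat n"] by simp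
qed (simp add: Q2_const_of_nat)

lemma q2_abs_of_int: "q2_abs (of_int z :: q2) = rat_abs2 (of_int z)"
proof -
  have "q2_abs (Q2 (\<lambda>_. of_int z)) = rat_abs2 (of_int z)"
    by (subst q2_abs_Q2) (simp_all add: limI)
  then show ?thesis by (simp add: Q2_const_of_int)
qed

instance q2 :: field_char_0
proof
  show "inj (of_nat :: nat \<Rightarrow> q2)"
  proof (rule injI)
    fix m n assume "of_nat m = (of_nat n :: q2)"
    then have "q2_abs (of_int (int m - int n) :: q2) = 0" by simp
    then show "m = n" unfolding q2_abs_of_int by simp
  qed
qed

lemma Q2_const: "Q2 (\<lambda>_. q) = of_rat q"
proof -
  obtain a b where ab: "quotient_of q = (a, b)" by force
  then have b: "b > 0" and q: "q = of_int a / of_int b"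
    using quotient_of_denom_pos[OF ab] quotient_of_div[OF ab] by auto
  have "Q2 (\<lambda>_. q) * Q2 (\<lambda>_. of_int b) = Q2 (\<lambda>_. of_int a)"
    using q b by (subst mult_Q2) auto
  then show ?thesis using b unfolding q Q2_const_of_int
    by (simp add: of_rat_divide field_simps)
qed

lemma q2_abs_of_rat: "q2_abs (of_rat q :: q2) = rat_abs2 q"
  unfolding Q2_const[symmetric] by (subst q2_abs_Q2) (simp_all add: limI)

lemma q2_abs_power2: "q2_abs (2 ^ n :: q2) = 1 / 2 ^ n"
  using q2_abs_of_int[of "2 ^ n"] rat_abs2_power2[of n] by simp

instantiation q2 :: metric_space
begin

definition dist_q2 :: "q2 \<Rightarrow> q2 \<Rightarrow> real" where "dist_q2 x y = q2_abs (x - y)"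

definition uniformity_q2 :: "(q2 \<times> q2) filter" where
  "uniformity_q2 = (INF e\<in>{0<..}. principal {(x, y). dist x y < e})"

definition open_q2 :: "q2 set \<Rightarrow> bool" where
  "open_q2 U \<longleftrightarrow> (\<forall>x\<in>U. \<forall>\<^sub>F (x', y) in uniformity. x' = x \<longrightarrow> y \<in> U)"

instance
proof
  fix x y z :: q2
  show "dist x y = 0 \<longleftrightarrow> x = y" by (simp add: dist_q2_def)
  have "dist x y \<le> max (dist x z) (dist y z)"
    using q2_abs_ultra_diff[of "x - z" "y - z"] by (simp add: dist_q2_def)
  then show "dist x y \<le> dist x z + dist y z"
    using q2_abs_nonneg unfolding dist_q2_def by (smt (verit))
qed (rule uniformity_q2_def open_q2_def)+

end

section \<open>The 2-adic integers and their cosets\<close>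

definition Z2 :: "q2 set" where
  "Z2 = {x. q2_abs x \<le> 1}"

definition coset2 :: "nat \<Rightarrow> q2 \<Rightarrow> q2 set" where
  "coset2 j x = {x + 2 ^ j * z | z. z \<in> Z2}"

lemma coset2_iff: "y \<in> coset2 j x \<longleftrightarrow> q2_abs (y - x) \<le> 1 / 2 ^ j"
proof
  assume "y \<in> coset2 j x"
  then show "q2_abs (y - x) \<le> 1 / 2 ^ j"
    by (auto simp: coset2_def Z2_def q2_abs_power2 divide_simps)
next
  assume *: "q2_abs (y - x) \<le> 1 / 2 ^ j"
  have "q2_abs (2 ^ j) * q2_abs ((y - x) / 2 ^ j) = q2_abs (y - x)"
    by (subst q2_abs_mult[symmetric]) simp
  with * have "(y - x) / 2 ^ j \<in> Z2"
    by (simp add: Z2_def q2_abs_power2 divide_simps)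
  moreover have "y = x + 2 ^ j * ((y - x) / 2 ^ j)" by simp
  ultimately show "y \<in> coset2 j x" unfolding coset2_def by blast
qed

lemma Z2_add: "x \<in> Z2 \<Longrightarrow> y \<in> Z2 \<Longrightarrow> x + y \<in> Z2"
  using q2_abs_ultra[of x y] by (simp add: Z2_def)

lemma Z2_minus: "x \<in> Z2 \<Longrightarrow> - x \<in> Z2"
  by (simp add: Z2_def)

lemma Z2_of_int [simp]: "of_int k \<in> Z2"
  using rat_abs2_of_int_le_iff[of k 0] by (simp add: Z2_def q2_abs_of_int)

lemma Z2_of_nat [simp]: "of_nat k \<in> Z2"
  using Z2_of_int[of "int k"] by simp

lemma Z2_0 [simp]: "0 \<in> Z2"
  using Z2_of_nat[of 0] by simp

lemma coset2_0 [simp]: "coset2 0 0 = Z2"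
  by (auto simp: coset2_iff Z2_def)

lemma coset2_subset_Z2: "x \<in> Z2 \<Longrightarrow> coset2 j x \<subseteq> Z2"
proof
  fix y assume x: "x \<in> Z2" and "y \<in> coset2 j x"
  then have "q2_abs (y - x) \<le> 1 / 2 ^ j" by (simp add: coset2_iff)
  also have "\<dots> \<le> 1" by simp
  finally show "y \<in> Z2" using x q2_abs_ultra[of "y - x" x] by (simp add: Z2_def)
qed

lemma coset2_refl: "x \<in> coset2 j x"
  by (simp add: coset2_iff)

lemma coset2_mono:
  assumes "i \<le> j" "y \<in> coset2 i x" shows "coset2 j y \<subseteq> coset2 i x"
proof
  fix z assume "z \<in> coset2 j y"
  then have "q2_abs (z - y) \<le> 1 / 2 ^ j" by (simp add: coset2_iff)
  also have "\<dots> \<le> 1 / 2 ^ i" using assms by (simp add: frac_le)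
  finally show "z \<in> coset2 i x"
    using assms q2_abs_ultra[of "z - y" "y - x"] by (simp add: coset2_iff)
qed

lemma coset2_sym: "y \<in> coset2 j x \<longleftrightarrow> x \<in> coset2 j y"
  by (simp add: coset2_iff q2_abs_diff_commute)

lemma coset2_eq: "y \<in> coset2 j x \<Longrightarrow> coset2 j y = coset2 j x"
  using coset2_mono[OF order_refl, of y j x] coset2_mono[OF order_refl, of x j y]
    coset2_sym[of y j x] by blast

lemma coset2_translate: "(+) y ` coset2 j x = coset2 j (y + x)"
proof (intro set_eqI iffI)
  fix z assume "z \<in> coset2 j (y + x)"
  then have "z - y \<in> coset2 j x" by (simp add: coset2_iff algebra_simps)
  then show "z \<in> (+) y ` coset2 j x" by (auto intro!: image_eqI[of _ _ "z - y"])
qed (auto simp: coset2_iff)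

lemma open_coset2: "open (coset2 j x)"
  unfolding open_dist
proof (intro ballI exI[of _ "1 / 2 ^ j"] conjI allI impI)
  fix y z assume "y \<in> coset2 j x" "dist z y < 1 / 2 ^ j"
  then show "z \<in> coset2 j x"
    using q2_abs_ultra[of "z - y" "y - x"] by (simp add: coset2_iff dist_q2_def)
qed simp

lemma open_Z2: "open Z2"
  using open_coset2[of 0 0] by simp

lemma open_contains_coset2:
  assumes "open U" "x \<in> U" obtains j where "coset2 j x \<subseteq> U"
proof -
  obtain e where e: "e > 0" "\<And>y. dist y x < e \<Longrightarrow> y \<in> U"
    using assms unfolding open_dist by blast
  obtain j where j: "(1 / 2 :: real) ^ j < e" using real_arch_pow_inv[of e "1/2"] e by auto
  have "coset2 j x \<subseteq> U"
    using j by (auto simp: coset2_iff dist_q2_def power_one_over intro!: e(2))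
  then show ?thesis using that by blast
qed

lemma q2_abs_limit_le:
  assumes X: "cauchy2 X" and le: "\<And>n. n \<ge> N \<Longrightarrow> rat_abs2 (X n - q) \<le> c"
  shows "q2_abs (Q2 X - of_rat q) \<le> c"
proof -
  have "(\<lambda>n. rat_abs2 (X n - q)) \<longlonglongrightarrow> q2_abs (Q2 X - of_rat q)"
    using tendsto_q2_abs_Q2[OF cauchy2_diff[OF X cauchy2_const[of q]]]
    by (simp add: diff_Q2[OF X] Q2_const[symmetric])
  then show ?thesis by (rule LIMSEQ_le_const2) (use le in blast)
qed

lemma rat_abs2_le_1_approx:
  assumes "rat_abs2 r \<le> 1"
  obtains k where "rat_abs2 (r - of_int k) \<le> 1 / 2 ^ j"
proof (cases "r = 0")
  case False
  obtain a b where ab: "quotient_of r = (a, b)" by force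
  have b: "b > 0" and r: "r = of_int a / of_int b" and cop: "coprime a b"
    using quotient_of_denom_pos[OF ab] quotient_of_div[OF ab] quotient_of_coprime[OF ab] by auto
  have a: "a \<noteq> 0" using False r by auto
  have "rat_abs2 (of_int a / of_int b) = 2 ^ multiplicity 2 b / 2 ^ multiplicity 2 a"
    using a b by (intro rat_abs2_divide) auto
  with assms r have "(2::real) ^ multiplicity 2 b \<le> 2 ^ multiplicity 2 a" by (simp add: divide_simps)
  then have le: "multiplicity 2 b \<le> multiplicity 2 a" by simp
  have odd: "odd b"
  proof
    assume "even b"
    then have "multiplicity 2 b > 0" using b by (simp add: prime_multiplicity_gt_zero_iff)
    with le have "even a" using a by (metis less_le_trans not_dvd_imp_multiplicity_0 less_irrefl)
    with \<open>even b\<close> cop show False by (meson coprime_common_divisor not_is_unit_0 odd_one)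
  qed
  then have "coprime b (2 ^ j)" by simp
  then obtain u v where uv: "u * b + v * 2 ^ j = 1" using bezout_int[of b "2 ^ j"] by auto
  have abs_b: "rat_abs2 (of_int b) = 1"
    using rat_abs2_divide[of b 1] b odd by (simp add: not_dvd_imp_multiplicity_0)
  have "r - of_int (a * u) = of_int (a * (1 - u * b)) * inverse (of_int b)"
    using b r by (simp add: field_simps)
  also have "1 - u * b = v * 2 ^ j" using uv by simp
  finally have "rat_abs2 (r - of_int (a * u)) = rat_abs2 (of_int (a * (v * 2 ^ j)))"
    using abs_b by (simp only: rat_abs2_mult rat_abs2_inverse) simp
  also have "\<dots> \<le> 1 / 2 ^ j" unfolding rat_abs2_of_int_le_iff by simp
  finally show ?thesis by (rule that)
qed (use that[of 0] in simp)

lemma Z2_approx: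
  assumes x: "x \<in> Z2"
  obtains k where "k < 2 ^ j" "x \<in> coset2 j (of_nat k)"
proof (cases x)
  case (Q2 X)
  have "(1 :: real) / 2 ^ j > 0" by simp
  then obtain N where N: "\<forall>m\<ge>N. \<forall>n\<ge>N. rat_abs2 (X m - X n) < 1 / 2 ^ j"
    using Q2(1) unfolding cauchy2_def by blast
  define r where "r = X N"
  have 1: "q2_abs (x - of_rat r) \<le> 1 / 2 ^ j"
    unfolding Q2(2) r_def using N by (intro q2_abs_limit_le[OF Q2(1), of N]) (simp add: less_imp_le)
  also have "\<dots> \<le> 1" by simp
  finally have "rat_abs2 r \<le> 1"
    using x q2_abs_ultra_diff[of x "x - of_rat r"] by (simp add: Z2_def q2_abs_of_rat)
  then obtain k where k: "rat_abs2 (r - of_int k) \<le> 1 / 2 ^ j"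
    by (rule rat_abs2_le_1_approx)
  then have 2: "q2_abs (of_rat r - of_int k) \<le> 1 / 2 ^ j"
    unfolding q2_abs_of_rat[symmetric] by (simp add: of_rat_diff)
  define m where "m = nat (k mod 2 ^ j)"
  have m: "int m = k mod 2 ^ j" by (simp add: m_def)
  have "q2_abs (of_int (k - int m)) \<le> 1 / 2 ^ j"
    unfolding q2_abs_of_int rat_abs2_of_int_le_iff m by (simp add: minus_mod_eq_mult_div)
  then have 3: "q2_abs (of_int k - of_nat m) \<le> 1 / 2 ^ j" by simp
  have "x \<in> coset2 j (of_rat r)" "of_rat r \<in> coset2 j (of_int k)" "of_int k \<in> coset2 j (of_nat m)"
    using 1 2 3 by (auto simp: coset2_iff)
  then have "x \<in> coset2 j (of_nat m)" using coset2_eq by metis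
  moreover have "int m < 2 ^ j" unfolding m by simp
  then have "m < 2 ^ j" by (metis of_nat_less_iff of_nat_numeral of_nat_power)
  ultimately show ?thesis using that by blast
qed

lemma coset2_of_nat_disjoint:
  assumes "k < 2 ^ j" "l < 2 ^ j" "x \<in> coset2 j (of_nat k)" "x \<in> coset2 j (of_nat l)"
  shows "k = l"
proof -
  have "of_nat k \<in> coset2 j (of_nat l)" using assms coset2_eq coset2_refl by metis
  then have "q2_abs (of_int (int k - int l)) \<le> 1 / 2 ^ j" by (simp add: coset2_iff)
  then have "2 ^ j dvd int k - int l" unfolding q2_abs_of_int rat_abs2_of_int_le_iff .
  then have "int k mod 2 ^ j = int l mod 2 ^ j" by (simp add: mod_eq_dvd_iff)
  moreover have "int k < 2 ^ j" "int l < 2 ^ j"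
    using assms(1,2) by (metis of_nat_less_iff of_nat_numeral of_nat_power)+
  ultimately show ?thesis by simp
qed

definition coset2_gen :: "q2 set set" where
  "coset2_gen = insert {} {coset2 j (of_nat k) | j k. k < 2 ^ j}"

lemma coset2_in_gen: "x \<in> Z2 \<Longrightarrow> coset2 j x \<in> coset2_gen"
proof -
  assume "x \<in> Z2"
  then obtain k where "k < 2 ^ j" "x \<in> coset2 j (of_nat k)" by (rule Z2_approx)
  then show ?thesis using coset2_eq unfolding coset2_gen_def by blast
qed

lemma coset2_gen_cases:
  assumes "A \<in> coset2_gen"
  obtains "A = {}" | j x where "x \<in> Z2" "A = coset2 j x"
proof (cases "A = {}")
  case False
  then obtain j k where "A = coset2 j (of_nat k)" using assms by (auto simp: coset2_gen_def)
  then show ?thesis using that(2)[OF Z2_of_nat] by blast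
qed (use that in blast)

lemma coset2_gen_subset: "coset2_gen \<subseteq> Pow Z2"
proof
  fix A assume "A \<in> coset2_gen"
  then show "A \<in> Pow Z2" by (cases rule: coset2_gen_cases) (auto dest: subsetD[OF coset2_subset_Z2])
qed

lemma Int_stable_coset2_gen: "Int_stable coset2_gen"
proof (rule Int_stableI)
  have *: "coset2 i x \<inter> coset2 j y \<in> coset2_gen" if "i \<le> j" "y \<in> Z2" for i j x y
  proof (cases "coset2 i x \<inter> coset2 j y = {}")
    case False
    then obtain z where "z \<in> coset2 i x" "z \<in> coset2 j y" by blast
    then have "coset2 i x \<inter> coset2 j y = coset2 j y"
      using coset2_mono[OF that(1)] coset2_eq by blast
    then show ?thesis using coset2_in_gen that by simp
  qed (simp add: coset2_gen_def)
  fix A B assume A: "A \<in> coset2_gen" and B: "B \<in> coset2_gen"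
  show "A \<inter> B \<in> coset2_gen"
  proof (cases "A = {} \<or> B = {}")
    case False
    then obtain i x j y where "x \<in> Z2" "A = coset2 i x" "y \<in> Z2" "B = coset2 j y"
      using coset2_gen_cases[OF A] coset2_gen_cases[OF B] by metis
    then show ?thesis using *[of i j y x] *[of j i x y] by (cases "i \<le> j") (auto simp: Int_commute)
  qed (auto simp: coset2_gen_def)
qed

lemma countable_coset2_gen: "countable coset2_gen"
proof -
  have "coset2_gen \<subseteq> insert {} (range (\<lambda>(j, k). coset2 j (of_nat k)))"
    by (auto simp: coset2_gen_def)
  moreover have "countable (insert {} (range (\<lambda>(j::nat, k::nat). coset2 j (of_nat k))))"
    by simp
  ultimately show ?thesis by (rule countable_subset)
qed

lemma sets_restrict_Z2: "sets (restrict_space borel Z2) = sigma_sets Z2 coset2_gen"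
proof -
  have "sets (restrict_space borel Z2) = (\<inter>) Z2 ` sigma_sets UNIV {S. open S}"
    by (simp add: sets_restrict_space borel_def)
  also have "\<dots> = sigma_sets Z2 ((\<inter>) Z2 ` {S. open S})"
    using open_Z2 by (intro sigma_sets_Int) auto
  also have "\<dots> = sigma_sets Z2 coset2_gen"
  proof (rule sigma_sets_eqI)
    fix A assume "A \<in> (\<inter>) Z2 ` {S. open S}"
    then have A: "open A" "A \<subseteq> Z2" using open_Z2 by auto
    have "A = \<Union>{B \<in> coset2_gen. B \<subseteq> A}"
    proof (intro equalityI subsetI)
      fix x assume "x \<in> A"
      with A obtain j where "coset2 j x \<subseteq> A" using open_contains_coset2 by blast
      moreover have "coset2 j x \<in> coset2_gen" using A \<open>x \<in> A\<close> coset2_in_gen by blast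
      ultimately show "x \<in> \<Union>{B \<in> coset2_gen. B \<subseteq> A}" using coset2_refl by blast
    qed auto
    moreover have "countable {B \<in> coset2_gen. B \<subseteq> A}"
      using countable_coset2_gen by (rule countable_subset[rotated]) auto
    ultimately show "A \<in> sigma_sets Z2 coset2_gen"
      by (metis (no_types, lifting) mem_Collect_eq sigma_sets.Basic sigma_sets_UNION)
  next
    fix A assume "A \<in> coset2_gen"
    then have "open A" "A \<subseteq> Z2"
      using coset2_gen_subset open_coset2 by (auto elim: coset2_gen_cases)
    then have "A \<in> (\<inter>) Z2 ` {S. open S}" by blast
    then show "A \<in> sigma_sets Z2 ((\<inter>) Z2 ` {S. open S})" by blast
  qed
  finally show ?thesis .
qed

section \<open>Normalized Haar measure\<close>

definition normalized_haar :: "q2 measure \<Rightarrow> bool" where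
  "normalized_haar \<mu> \<longleftrightarrow> sets \<mu> = sets (restrict_space borel Z2) \<and>
    (\<forall>y\<in>Z2. \<forall>A\<in>sets \<mu>. emeasure \<mu> ((+) y ` A) = emeasure \<mu> A) \<and>
    emeasure \<mu> Z2 = 1"

text \<open>
  The description below is proper: \<open>normalized_haar_exists\<close> and \<open>normalized_haar_unique\<close> show
  that exactly one measure satisfies \<^const>\<open>normalized_haar\<close>.
\<close>

definition haar :: "q2 measure" where
  "haar = (THE \<mu>. normalized_haar \<mu>)"

lemma normalized_haar_coset2:
  assumes \<mu>: "normalized_haar \<mu>" and x: "x \<in> Z2"
  shows "emeasure \<mu> (coset2 j x) = ennreal (1 / 2 ^ j)"
proof -
  have sets: "coset2 j y \<in> sets \<mu>" if "y \<in> Z2" for y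
    using \<mu> coset2_in_gen[OF that] by (auto simp: normalized_haar_def sets_restrict_Z2)
  have eq: "emeasure \<mu> (coset2 j y) = emeasure \<mu> (coset2 j 0)" if "y \<in> Z2" for y
    using \<mu> that sets[of 0] coset2_translate[of y j 0]
    unfolding normalized_haar_def by (metis Z2_0 add_0_right)
  have "Z2 = (\<Union>k\<in>{..<2 ^ j}. coset2 j (of_nat k))"
  proof (intro equalityI subsetI)
    fix y assume "y \<in> Z2"
    then obtain k where "k < 2 ^ j" "y \<in> coset2 j (of_nat k)" by (rule Z2_approx)
    then show "y \<in> (\<Union>k\<in>{..<2 ^ j}. coset2 j (of_nat k))" by auto
  qed (use coset2_subset_Z2[OF Z2_of_nat] in auto)
  then have "1 = emeasure \<mu> (\<Union>k\<in>{..<2 ^ j}. coset2 j (of_nat k))"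
    using \<mu> by (simp add: normalized_haar_def)
  also have "\<dots> = (\<Sum>k\<in>{..<2 ^ j :: nat}. emeasure \<mu> (coset2 j (of_nat k)))"
    using sets coset2_of_nat_disjoint
    by (intro sum_emeasure[symmetric]) (auto simp: disjoint_family_on_def)
  also have "\<dots> = (\<Sum>k\<in>{..<2 ^ j :: nat}. emeasure \<mu> (coset2 j 0))"
    by (intro sum.cong refl eq) simp
  finally have m: "2 ^ j * emeasure \<mu> (coset2 j 0) = 1" by simp
  have "ennreal (1 / 2 ^ j) * (2 ^ j * emeasure \<mu> (coset2 j 0)) = emeasure \<mu> (coset2 j 0)"
  proof -
    have "ennreal (1 / 2 ^ j) * 2 ^ j = ennreal (1 / 2 ^ j * 2 ^ j)"
      by (subst ennreal_mult) (auto simp flip: ennreal_power)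
    then show ?thesis by (simp flip: mult.assoc)
  qed
  with m show ?thesis unfolding eq[OF x] by simp
qed

lemma normalized_haar_unique:
  assumes "normalized_haar \<mu>" "normalized_haar \<nu>" shows "\<mu> = \<nu>"
proof (rule measure_eqI_generator_eq[OF Int_stable_coset2_gen coset2_gen_subset, where A = "\<lambda>_. Z2"])
  show "emeasure \<mu> A = emeasure \<nu> A" if "A \<in> coset2_gen" for A
    using that by (cases rule: coset2_gen_cases) (auto simp: normalized_haar_coset2 assms)
  show "range (\<lambda>_. Z2) \<subseteq> coset2_gen" using coset2_in_gen[of 0 0] by auto
  show "sets \<mu> = sigma_sets Z2 coset2_gen" "sets \<nu> = sigma_sets Z2 coset2_gen"
    using assms unfolding normalized_haar_def sets_restrict_Z2 by blast+
  show "emeasure \<mu> Z2 \<noteq> \<infinity>" for i :: nat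
    using assms(1) unfolding normalized_haar_def by (metis ennreal_one_neq_top infinity_ennreal_def)
qed simp

text \<open>
  The measure is constructed as the image of fair coin tossing under the map sending a bit
  sequence \<open>w\<close> to the 2-adic integer with binary digits \<open>w\<close>.
\<close>

definition digit_sum :: "nat \<Rightarrow> (nat \<Rightarrow> bool) \<Rightarrow> nat" where
  "digit_sum n w = horner_sum of_bool 2 (map w [0..<n])"

lemma digit_sum_dvd:
  assumes "j \<le> n" shows "2 ^ j dvd int (digit_sum n w) - int (digit_sum j w)"
proof -
  obtain k where "n = j + k" using assms le_Suc_ex by blast
  then have "[0..<n] = [0..<j] @ [j..<n]" by (simp only: upt_add_eq_append[OF le0])
  then have "digit_sum n w = digit_sum j w + 2 ^ j * horner_sum of_bool 2 (map w [j..<n])"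
    by (simp add: digit_sum_def horner_sum_append)
  then show ?thesis by simp
qed

lemma digit_sum_close:
  "j \<le> n \<Longrightarrow> rat_abs2 (of_nat (digit_sum n w) - of_nat (digit_sum j w)) \<le> 1 / 2 ^ j"
  using digit_sum_dvd[of j n w] by (simp flip: rat_abs2_of_int_le_iff)

lemma cauchy2_digit_sum: "cauchy2 (\<lambda>n. of_nat (digit_sum n w))"
  unfolding cauchy2_def
proof (intro allI impI)
  fix e :: real assume "e > 0"
  then obtain j where j: "(1 / 2 :: real) ^ j < e" using real_arch_pow_inv[of e "1/2"] by auto
  have "rat_abs2 (of_nat (digit_sum m w) - of_nat (digit_sum n w)) < e" if "m \<ge> j" "n \<ge> j" for m n
    using digit_sum_close[OF that(1), of w] digit_sum_close[OF that(2), of w] j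
      rat_abs2_ultra[of "of_nat (digit_sum m w) - of_nat (digit_sum j w)"
        "of_nat (digit_sum j w) - of_nat (digit_sum n w)"]
      rat_abs2_diff_commute[of "of_nat (digit_sum j w)" "of_nat (digit_sum n w)"]
    by (simp add: power_one_over)
  then show "\<exists>N. \<forall>m\<ge>N. \<forall>n\<ge>N.
      rat_abs2 (of_nat (digit_sum m w) - of_nat (digit_sum n w)) < e" by blast
qed

definition digit_limit :: "(nat \<Rightarrow> bool) \<Rightarrow> q2" where
  "digit_limit w = Q2 (\<lambda>n. of_nat (digit_sum n w))"

lemma digit_limit_coset2: "digit_limit w \<in> coset2 j (of_nat (digit_sum j w))"
proof -
  have "q2_abs (digit_limit w - of_rat (of_nat (digit_sum j w))) \<le> 1 / 2 ^ j"
    unfolding digit_limit_def by (rule q2_abs_limit_le[OF cauchy2_digit_sum digit_sum_close])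
  then show ?thesis by (simp add: coset2_iff)
qed

lemma digit_limit_Z2: "digit_limit w \<in> Z2"
  using digit_limit_coset2[of w 0] by (simp add: digit_sum_def)

lemma digit_sum_less: "digit_sum j w < 2 ^ j"
  using horner_sum_of_bool_2_less[of "map w [0..<j]", where 'a = nat] by (simp add: digit_sum_def)

lemma digit_limit_in_coset2_iff:
  assumes "k < 2 ^ j"
  shows "digit_limit w \<in> coset2 j (of_nat k) \<longleftrightarrow> (\<forall>i<j. w i = bit k i)"
proof -
  have "digit_limit w \<in> coset2 j (of_nat k) \<longleftrightarrow> digit_sum j w = k"
    using digit_limit_coset2 coset2_of_nat_disjoint[OF digit_sum_less assms] by blast
  also have "\<dots> \<longleftrightarrow> (\<forall>i<j. w i = bit k i)"
  proof
    assume "digit_sum j w = k"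
    then show "\<forall>i<j. w i = bit k i" by (auto simp: digit_sum_def bit_horner_sum_bit_iff)
  next
    assume "\<forall>i<j. w i = bit k i"
    then have "digit_sum j w = horner_sum of_bool 2 (map (bit k) [0..<j])"
      unfolding digit_sum_def by (intro arg_cong[where f = "horner_sum of_bool 2"]) simp
    also have "\<dots> = k" unfolding horner_sum_bit_eq_take_bit
      using assms by (rule take_bit_nat_eq_self)
    finally show "digit_sum j w = k" .
  qed
  finally show ?thesis .
qed

definition coin2 :: "(nat \<Rightarrow> bool) measure" where
  "coin2 = PiM UNIV (\<lambda>_. measure_pmf (bernoulli_pmf (1 / 2)))"

lemma space_coin2 [simp]: "space coin2 = UNIV"
  by (simp add: coin2_def space_PiM)

lemma emeasure_coin2:
  assumes "k < 2 ^ j"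
  shows "digit_limit -` coset2 j (of_nat k) \<in> sets coin2"
    "emeasure coin2 (digit_limit -` coset2 j (of_nat k)) = ennreal (1 / 2 ^ j)"
proof -
  interpret product_prob_space "\<lambda>_::nat. measure_pmf (bernoulli_pmf (1 / 2))" UNIV
    by (simp add: product_prob_space_def product_prob_space_axioms_def product_sigma_finite_def
        measure_pmf.prob_space_axioms prob_space_imp_sigma_finite)
  have eq: "digit_limit -` coset2 j (of_nat k)
      = {w \<in> space (PiM UNIV (\<lambda>_::nat. measure_pmf (bernoulli_pmf (1 / 2)))). \<forall>i\<in>{..<j}. w i \<in> {bit k i}}"
    using digit_limit_in_coset2_iff[OF assms] by (auto simp: space_PiM)
  show "digit_limit -` coset2 j (of_nat k) \<in> sets coin2"
    unfolding eq coin2_def by (intro sets.sets_Collect_finite_All sets_Collect_single') auto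
  have "emeasure coin2 (digit_limit -` coset2 j (of_nat k))
      = (\<Prod>i\<in>{..<j}. emeasure (measure_pmf (bernoulli_pmf (1 / 2))) {bit k i})"
    unfolding eq coin2_def by (rule emeasure_PiM_Collect) auto
  also have "\<dots> = (\<Prod>i\<in>{..<j}. ennreal (1 / 2))"
  proof (intro prod.cong refl)
    show "emeasure (measure_pmf (bernoulli_pmf (1 / 2))) {bit k i} = ennreal (1 / 2)" for i
      by (cases "bit k i") (simp_all add: emeasure_pmf_single)
  qed
  also have "\<dots> = ennreal (1 / 2 ^ j)" 
    by (subst prod_ennreal) (auto simp: power_one_over)
  finally show "emeasure coin2 (digit_limit -` coset2 j (of_nat k)) = ennreal (1 / 2 ^ j)" .
qed

lemma normalized_haar_exists: "\<exists>\<mu>. normalized_haar \<mu>"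
proof
  define \<mu> where "\<mu> = distr coin2 (restrict_space borel Z2) digit_limit"
  have sets: "sets \<mu> = sigma_sets Z2 coset2_gen"
    by (simp add: \<mu>_def sets_restrict_Z2)
  have meas: "digit_limit \<in> measurable coin2 (restrict_space borel Z2)"
    by (rule measurable_sigma_sets[OF sets_restrict_Z2 coset2_gen_subset])
      (auto simp: digit_limit_Z2 coset2_gen_def emeasure_coin2)
  have coset: "emeasure \<mu> (coset2 j x) = ennreal (1 / 2 ^ j)" if x: "x \<in> Z2" for j x
  proof -
    obtain k where k: "k < 2 ^ j" "x \<in> coset2 j (of_nat k)" using Z2_approx[OF x] by blast
    have "coset2 j x \<in> sets (restrict_space borel Z2)"
      unfolding sets_restrict_Z2 using coset2_in_gen[OF x] by blast
    then show ?thesis unfolding \<mu>_def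
      using meas emeasure_coin2[OF k(1)] coset2_eq[OF k(2)] by (simp add: emeasure_distr)
  qed
  have Z2_sets: "Z2 \<in> sets \<mu>" unfolding sets by (rule sigma_sets_top)
  have space: "space \<mu> = Z2" using open_Z2 by (simp add: \<mu>_def space_restrict_space)
  have inv: "emeasure \<mu> ((+) y ` A) = emeasure \<mu> A" if y: "y \<in> Z2" and A: "A \<in> sets \<mu>" for y A
  proof -
    have vim: "(\<lambda>x. x - y) -` coset2 j x \<inter> Z2 = coset2 j (y + x)" if "x \<in> Z2" for j x
      using coset2_subset_Z2[OF Z2_add[OF y that], of j] by (auto simp: coset2_iff algebra_simps)
    have m: "(\<lambda>x. x - y) \<in> measurable \<mu> \<mu>"
    proof (rule measurable_sigma_sets[OF sets coset2_gen_subset])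
      show "(\<lambda>x. x - y) \<in> space \<mu> \<rightarrow> Z2"
        using Z2_add[OF _ Z2_minus[OF y]] by (auto simp: space)
      fix B assume "B \<in> coset2_gen"
      then show "(\<lambda>x. x - y) -` B \<inter> space \<mu> \<in> sets \<mu>"
        by (cases rule: coset2_gen_cases)
          (auto simp: space vim sets intro: sigma_sets.Empty intro!: sigma_sets.Basic[OF coset2_in_gen] Z2_add y)
    qed
    have "distr \<mu> \<mu> (\<lambda>x. x - y) = \<mu>"
    proof (rule measure_eqI_generator_eq[OF Int_stable_coset2_gen coset2_gen_subset, where A = "\<lambda>_. Z2"])
      show "emeasure (distr \<mu> \<mu> (\<lambda>x. x - y)) B = emeasure \<mu> B" if "B \<in> coset2_gen" for B
        using that
      proof (cases rule: coset2_gen_cases)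
        case (2 j x)
        have "B \<in> sets \<mu>" using that sets by blast
        then show ?thesis using m 2 y by (simp add: emeasure_distr space vim coset Z2_add)
      qed auto
      show "range (\<lambda>_. Z2) \<subseteq> coset2_gen" using coset2_in_gen[of 0 0] by auto
      have "emeasure (distr \<mu> \<mu> (\<lambda>x. x - y)) Z2 = emeasure \<mu> ((\<lambda>x. x - y) -` Z2 \<inter> Z2)"
        using m Z2_sets by (simp add: emeasure_distr space)
      also have "\<dots> \<le> emeasure \<mu> Z2" using Z2_sets by (intro emeasure_mono) auto
      also have "\<dots> = 1" using coset[of 0 0] by simp
      finally show "emeasure (distr \<mu> \<mu> (\<lambda>x. x - y)) Z2 \<noteq> \<infinity>" for i :: nat
        by (auto simp: top_unique)
    qed (auto simp: sets)
    moreover have "(\<lambda>x. x - y) -` A \<inter> space \<mu> = (+) y ` A"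
    proof -
      have "A \<subseteq> Z2" using sets.sets_into_space[OF A] space by simp
      then show ?thesis using Z2_add[OF y]
        by (auto simp: space image_iff intro!: bexI[of _ "_ - y"])
    qed
    ultimately show ?thesis using m A by (metis emeasure_distr)
  qed
  show "normalized_haar \<mu>"
    unfolding normalized_haar_def using coset[of 0 0] inv by (simp add: sets sets_restrict_Z2)
qed

lemma normalized_haar_haar: "normalized_haar haar"
proof -
  have "\<exists>!\<mu>. normalized_haar \<mu>"
    using normalized_haar_exists normalized_haar_unique by (rule ex_ex1I)
  then show ?thesis unfolding haar_def by (rule theI')
qed

section \<open>Besov and BV norms\<close>

text \<open>
  A function on \<^const>\<open>Z2\<close> is represented by a function on all of \<^typ>\<open>q2\<close>. Its values outside
  \<^const>\<open>Z2\<close> are irrelevant in the definitions below: \<^const>\<open>haar\<close> has underlying space \<^const>\<open>Z2\<close>,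
  cosets of points of \<^const>\<open>Z2\<close> are subsets of \<^const>\<open>Z2\<close>, and \<^const>\<open>Z2\<close> is closed under addition.
  Norms take values in \<^typ>\<open>ennreal\<close>; in particular the infimum defining the BV norm is infinite
  when there is no admissible constant.
\<close>

definition S2 :: "nat \<Rightarrow> (q2 \<Rightarrow> real) \<Rightarrow> q2 \<Rightarrow> real" where
  "S2 j f x = 1 / measure haar (coset2 j x) * (LINT y:coset2 j x|haar. f y)"

definition Delta2 :: "nat \<Rightarrow> (q2 \<Rightarrow> real) \<Rightarrow> q2 \<Rightarrow> real" where
  "Delta2 j f x = S2 (j + 1) f x - S2 j f x"

definition L1_norm :: "(q2 \<Rightarrow> real) \<Rightarrow> ennreal" where
  "L1_norm f = (\<integral>\<^sup>+ x. ennreal \<bar>f x\<bar> \<partial>haar)"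

definition besov_norm :: "(q2 \<Rightarrow> real) \<Rightarrow> ennreal" where
  "besov_norm f = (SUP j. 2 ^ j * L1_norm (Delta2 j f))"

definition besov :: "(q2 \<Rightarrow> real) set" where
  "besov = {f. besov_norm f < \<infinity>}"

definition BV_bounds :: "(q2 \<Rightarrow> real) \<Rightarrow> real set" where
  "BV_bounds f = {C. C > 0 \<and>
    (\<forall>y\<in>Z2. L1_norm (\<lambda>x. f (x + y) - f x) \<le> ennreal (C * q2_abs y))}"

definition BV :: "(q2 \<Rightarrow> real) set" where
  "BV = {f. BV_bounds f \<noteq> {}}"

definition BV_norm :: "(q2 \<Rightarrow> real) \<Rightarrow> ennreal" where
  "BV_norm f = (INF C\<in>BV_bounds f. ennreal C)"

end

theory Submission
  imports Defs
begin

text \<open>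
  The coset of \<open>2^j\<close> at \<open>x\<close> splits into the two cosets of \<open>2^(j+1)\<close> at \<open>x\<close> and \<open>x + 2^j\<close>, so
  \<open>\<Delta>\<^sub>j f(x) = (S\<^sub>j\<^sub>+\<^sub>1 f(x) - S\<^sub>j\<^sub>+\<^sub>1 f(x + 2^j)) / 2\<close>. Since averaging contracts \<open>L\<^sup>1\<close> and commutes
  with translation, the norm of this block is at most the norm of \<open>f(\<cdot> + 2^j) - f\<close>.
  Conversely, if \<open>\<bar>y\<bar> \<le> 2^(-j)\<close> then \<open>S\<^sub>j f\<close> is invariant under translation by \<open>y\<close>, so
  \<open>f(\<cdot> + y) - f\<close> has norm at most twice that of \<open>f - S\<^sub>j f\<close>. The latter is the sum of the blocks
  \<open>\<Delta>\<^sub>k f\<close> with \<open>k \<ge> j\<close>, a geometric series, because \<open>S\<^sub>n f\<close> converges to \<open>f\<close> in \<open>L\<^sup>1\<close> by the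
  density of locally constant functions.
\<close>

section \<open>Haar measure\<close>

lemma sets_haar: "sets haar = sets (restrict_space borel Z2)"
  using normalized_haar_haar by (simp add: normalized_haar_def)

lemma space_haar [simp]: "space haar = Z2"
  using sets_eq_imp_space_eq[OF sets_haar] open_Z2 by (simp add: space_restrict_space)

interpretation haar: prob_space haar
  using normalized_haar_haar by (intro prob_spaceI) (simp add: normalized_haar_def)

lemma sets_haar_gen: "sets haar = sigma_sets Z2 coset2_gen"
  by (simp add: sets_haar sets_restrict_Z2)

lemma coset2_sets [measurable]: "x \<in> Z2 \<Longrightarrow> coset2 j x \<in> sets haar"
  using coset2_in_gen by (auto simp: sets_haar_gen)

lemma emeasure_coset2: "x \<in> Z2 \<Longrightarrow> emeasure haar (coset2 j x) = ennreal (1 / 2 ^ j)"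
  by (rule normalized_haar_coset2[OF normalized_haar_haar])

lemma measure_coset2: "x \<in> Z2 \<Longrightarrow> measure haar (coset2 j x) = 1 / 2 ^ j"
  by (simp add: measure_def emeasure_coset2)

text \<open>\<open>normalized_haar\<close> speaks only of images of measurable sets, so
  measurability has to be checked on the generators: the preimage of a coset at \<open>x\<close> is
  the coset of the same level at \<open>x - y\<close>.\<close>

lemma measurable_translate:
  assumes y: "y \<in> Z2" shows "(\<lambda>x. x + y) \<in> measurable haar haar"
proof (rule measurable_sigma_sets[OF sets_haar_gen coset2_gen_subset])
  show "(\<lambda>x. x + y) \<in> space haar \<rightarrow> Z2" using Z2_add[OF _ y] by auto
  fix B assume "B \<in> coset2_gen"
  then show "(\<lambda>x. x + y) -` B \<inter> space haar \<in> sets haar"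
  proof (cases rule: coset2_gen_cases)
    case (2 j x)
    have m: "x - y \<in> Z2" using Z2_add[OF 2(1) Z2_minus[OF y]] by simp
    have "(\<lambda>x. x + y) -` B \<inter> space haar = coset2 j (x - y)"
      using coset2_subset_Z2[OF m, of j] 2 by (auto simp: coset2_iff algebra_simps)
    then show ?thesis using m by simp
  qed simp
qed

text \<open>Invariance restated as an equality of push-forward measures, the form from which the
  change of variables rules for integrals follow.\<close>

lemma haar_translate:
  assumes y: "y \<in> Z2" shows "distr haar haar (\<lambda>x. x + y) = haar"
proof (rule measure_eqI)
  fix A assume "A \<in> sets (distr haar haar (\<lambda>x. x + y))"
  then have A: "A \<in> sets haar" by simp
  let ?B = "(\<lambda>x. x + y) -` A \<inter> space haar"
  have B: "?B \<in> sets haar" using measurable_translate[OF y] A by (rule measurable_sets)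
  have "A \<subseteq> Z2" using sets.sets_into_space[OF A] by simp
  then have "x - y \<in> ?B" if "x \<in> A" for x
    using that Z2_add[OF _ Z2_minus[OF y], of x] by auto
  then have "(+) y ` ?B = A"
    by (force simp: add.commute intro: image_eqI[of _ _ "_ - y"])
  then have "emeasure haar A = emeasure haar ?B"
    using normalized_haar_haar B y unfolding normalized_haar_def by metis
  then show "emeasure (distr haar haar (\<lambda>x. x + y)) A = emeasure haar A"
    using measurable_translate[OF y] A by (simp add: emeasure_distr)
qed simp

lemma measurable_comp_translate [measurable]:
  "y \<in> Z2 \<Longrightarrow> f \<in> borel_measurable haar \<Longrightarrow> (\<lambda>x. f (x + y)) \<in> borel_measurable haar"
  by (rule measurable_compose[OF measurable_translate])

lemma integrable_translate:
  fixes f :: "q2 \<Rightarrow> real"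
  assumes "y \<in> Z2" "integrable haar f" shows "integrable haar (\<lambda>x. f (x + y))"
  using integrable_distr[OF measurable_translate[OF assms(1)], of f] assms
  by (simp add: haar_translate)

lemma integral_translate:
  fixes f :: "q2 \<Rightarrow> real"
  assumes "y \<in> Z2" "f \<in> borel_measurable haar" shows "(LINT x|haar. f (x + y)) = (LINT x|haar. f x)"
  using integral_distr[OF measurable_translate[OF assms(1)] assms(2)] assms
  by (simp add: haar_translate)

section \<open>The \<open>L1\<close> seminorm with values in \<open>ennreal\<close>\<close>

lemma L1_norm_translate:
  assumes "y \<in> Z2" "f \<in> borel_measurable haar" shows "L1_norm (\<lambda>x. f (x + y)) = L1_norm f"
  using nn_integral_distr[OF measurable_translate[OF assms(1)], of "\<lambda>x. ennreal \<bar>f x\<bar>"] assms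
  by (simp add: haar_translate L1_norm_def)

lemma L1_norm_mono: "(\<And>x. x \<in> Z2 \<Longrightarrow> \<bar>f x\<bar> \<le> \<bar>g x\<bar>) \<Longrightarrow> L1_norm f \<le> L1_norm g"
  unfolding L1_norm_def by (intro nn_integral_mono) (auto intro: ennreal_leI)

lemma L1_norm_cong: "(\<And>x. x \<in> Z2 \<Longrightarrow> f x = g x) \<Longrightarrow> L1_norm f = L1_norm g"
  by (intro antisym L1_norm_mono) auto

lemma L1_norm_add:
  assumes [measurable]: "f \<in> borel_measurable haar" "g \<in> borel_measurable haar"
  shows "L1_norm (\<lambda>x. f x + g x) \<le> L1_norm f + L1_norm g"
proof -
  have "L1_norm (\<lambda>x. f x + g x) \<le> (\<integral>\<^sup>+ x. ennreal \<bar>f x\<bar> + ennreal \<bar>g x\<bar> \<partial>haar)"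
    unfolding L1_norm_def
    by (intro nn_integral_mono) (auto simp flip: ennreal_plus intro: ennreal_leI)
  also have "\<dots> = L1_norm f + L1_norm g"
    unfolding L1_norm_def by (rule nn_integral_add) auto
  finally show ?thesis .
qed

lemma L1_norm_diff:
  assumes "f \<in> borel_measurable haar" "g \<in> borel_measurable haar"
  shows "L1_norm (\<lambda>x. f x - g x) \<le> L1_norm f + L1_norm g"
  using L1_norm_add[OF assms(1), of "\<lambda>x. - g x"] assms by (simp add: L1_norm_def)

lemma L1_norm_cmult:
  "f \<in> borel_measurable haar \<Longrightarrow> L1_norm (\<lambda>x. c * f x) = ennreal \<bar>c\<bar> * L1_norm f"
  unfolding L1_norm_def by (simp add: abs_mult ennreal_mult nn_integral_cmult)

section \<open>Locally constant functions\<close>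

text \<open>These are the functions that factor through the finite quotient of \<open>Z2\<close> by
  the multiples of \<open>2 ^ n\<close>.\<close>

definition level_const :: "nat \<Rightarrow> (q2 \<Rightarrow> 'a) \<Rightarrow> bool" where
  "level_const n g \<longleftrightarrow> (\<forall>x\<in>Z2. \<forall>y\<in>coset2 n x. g y = g x)"

lemma level_const_mono: "level_const m g \<Longrightarrow> m \<le> n \<Longrightarrow> level_const n g"
  unfolding level_const_def using coset2_mono[of m n] coset2_refl by (meson subsetD)

text \<open>The \<open>2 ^ n\<close> cosets partition \<open>Z2\<close>, so a single summand
  survives. The general semiring covers both real functions and \<open>ennreal\<close>
  integrands.\<close>

lemma sum_coset2:
  fixes c :: "nat \<Rightarrow> 'a :: semiring_1"
  assumes "k < 2 ^ n" "x \<in> coset2 n (of_nat k)"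
  shows "(\<Sum>i<2 ^ n. c i * indicator (coset2 n (of_nat i)) x) = c k"
proof -
  have "c i * indicator (coset2 n (of_nat i)) x = (if i = k then c i else 0)" if "i < 2 ^ n" for i
  proof (cases "i = k")
    case False
    then have "x \<notin> coset2 n (of_nat i)"
      using coset2_of_nat_disjoint[OF that assms(1) _ assms(2)] by blast
    then show ?thesis using False by simp
  qed (use assms(2) in simp)
  then have "(\<Sum>i<2 ^ n. c i * indicator (coset2 n (of_nat i)) x)
      = (\<Sum>i<2 ^ n. if i = k then c i else 0)"
    by (intro sum.cong) auto
  then show ?thesis using assms(1) by simp
qed

lemma level_const_expand:
  fixes g :: "q2 \<Rightarrow> 'a :: semiring_1"
  assumes "level_const n g" "x \<in> Z2"
  shows "g x = (\<Sum>i<2 ^ n. g (of_nat i) * indicator (coset2 n (of_nat i)) x)"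
proof -
  obtain k where k: "k < 2 ^ n" "x \<in> coset2 n (of_nat k)" using Z2_approx[OF assms(2)] .
  have "g x = g (of_nat k)" using assms(1) k(2) by (auto simp: level_const_def)
  with sum_coset2[OF k] show ?thesis by metis
qed

lemma level_const_measurable:
  fixes g :: "q2 \<Rightarrow> real"
  assumes "level_const n g" shows "g \<in> borel_measurable haar"
proof (subst measurable_cong)
  show "g x = (\<Sum>i<2 ^ n. g (of_nat i) * indicator (coset2 n (of_nat i)) x)"
    if "x \<in> space haar" for x
    using that by (intro level_const_expand[OF assms]) simp
qed (intro borel_measurable_sum borel_measurable_times borel_measurable_const
    borel_measurable_indicator coset2_sets Z2_of_nat)

lemma level_const_integrable:
  fixes g :: "q2 \<Rightarrow> real"
  assumes "level_const n g" shows "integrable haar g"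
proof -
  \<comment> \<open>A sum over all representatives dominates the single value taken at
    \<open>x\<close>; any constant bound suffices on a probability space.\<close>
  have "\<bar>g x\<bar> \<le> (\<Sum>i<2 ^ n. \<bar>g (of_nat i)\<bar>)" if x: "x \<in> Z2" for x
    unfolding level_const_expand[OF assms x]
    by (intro order_trans[OF sum_abs] sum_mono) (auto simp: indicator_def)
  then show ?thesis using level_const_measurable[OF assms]
    by (intro haar.integrable_const_bound[where B = "\<Sum>i<2 ^ n. \<bar>g (of_nat i)\<bar>"]) auto
qed

lemma nn_integral_cosets:
  assumes [measurable]: "h \<in> borel_measurable haar"
  shows "(\<integral>\<^sup>+ x. h x \<partial>haar) = (\<Sum>i<2 ^ n. \<integral>\<^sup>+ x. h x * indicator (coset2 n (of_nat i)) x \<partial>haar)"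
proof -
  have "(\<integral>\<^sup>+ x. h x \<partial>haar) = (\<integral>\<^sup>+ x. (\<Sum>i<2 ^ n. h x * indicator (coset2 n (of_nat i)) x) \<partial>haar)"
  proof (rule nn_integral_cong)
    fix x assume "x \<in> space haar"
    then have "x \<in> Z2" by simp
    then obtain k where k: "k < 2 ^ n" "x \<in> coset2 n (of_nat k)" by (rule Z2_approx)
    show "h x = (\<Sum>i<2 ^ n. h x * indicator (coset2 n (of_nat i)) x)"
      using sum_coset2[OF k, of "\<lambda>_. h x"] by simp
  qed
  also have "\<dots> = (\<Sum>i<2 ^ n. \<integral>\<^sup>+ x. h x * indicator (coset2 n (of_nat i)) x \<partial>haar)"
    by (rule nn_integral_sum) (auto intro!: borel_measurable_times borel_measurable_indicator)
  finally show ?thesis .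
qed

section \<open>Density of the locally constant functions in \<open>L1\<close>\<close>

definition approximable :: "(q2 \<Rightarrow> real) \<Rightarrow> bool" where
  "approximable f \<longleftrightarrow> (\<forall>e>0. \<exists>n g. level_const n g \<and> L1_norm (\<lambda>x. f x - g x) \<le> ennreal e)"

lemma approximable_of_level_const: "level_const n f \<Longrightarrow> approximable f"
  unfolding approximable_def by (auto intro!: exI[of _ n] exI[of _ f] simp: L1_norm_def)

lemma approximable_add:
  assumes f: "approximable f" "f \<in> borel_measurable haar"
    and g: "approximable g" "g \<in> borel_measurable haar"
  shows "approximable (\<lambda>x. f x + g x)"
  unfolding approximable_def
proof (intro allI impI)
  fix e :: real assume "e > 0"
  then have e: "e / 2 > 0" by simp
  obtain n u where u: "level_const n u" "L1_norm (\<lambda>x. f x - u x) \<le> ennreal (e / 2)"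
    using f(1) e unfolding approximable_def by blast
  obtain m v where v: "level_const m v" "L1_norm (\<lambda>x. g x - v x) \<le> ennreal (e / 2)"
    using g(1) e unfolding approximable_def by blast
  have [measurable]: "u \<in> borel_measurable haar" "v \<in> borel_measurable haar"
    using u v level_const_measurable by auto
  have "level_const (max n m) (\<lambda>x. u x + v x)"
    using level_const_mono[OF u(1), of "max n m"] level_const_mono[OF v(1), of "max n m"]
    by (auto simp: level_const_def)
  moreover have "L1_norm (\<lambda>x. (f x + g x) - (u x + v x)) \<le> ennreal e"
  proof -
    have "L1_norm (\<lambda>x. (f x - u x) + (g x - v x))
        \<le> L1_norm (\<lambda>x. f x - u x) + L1_norm (\<lambda>x. g x - v x)"
      using f(2) g(2) by (intro L1_norm_add) auto
    also have "\<dots> \<le> ennreal (e / 2) + ennreal (e / 2)" using u v by (intro add_mono)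
    also have "\<dots> = ennreal e" using e by (subst ennreal_plus[symmetric]) auto
    finally show ?thesis by (simp add: algebra_simps)
  qed
  ultimately show "\<exists>n h. level_const n h \<and> L1_norm (\<lambda>x. f x + g x - h x) \<le> ennreal e" by blast
qed

lemma approximable_cmult:
  assumes f: "approximable f" "f \<in> borel_measurable haar"
  shows "approximable (\<lambda>x. c * f x)"
  unfolding approximable_def
proof (intro allI impI)
  fix e :: real assume e: "e > 0"
  \<comment> \<open>The added 1 keeps the quotient meaningful when \<open>c = 0\<close>.\<close>
  define d where "d = e / (\<bar>c\<bar> + 1)"
  have d: "d > 0" "\<bar>c\<bar> * d \<le> e" using e by (auto simp: d_def field_simps)
  obtain n u where u: "level_const n u" "L1_norm (\<lambda>x. f x - u x) \<le> ennreal d"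
    using f(1) d(1) unfolding approximable_def by blast
  have "L1_norm (\<lambda>x. c * f x - c * u x) = L1_norm (\<lambda>x. c * (f x - u x))"
    by (simp add: right_diff_distrib)
  also have "\<dots> = ennreal \<bar>c\<bar> * L1_norm (\<lambda>x. f x - u x)"
    using f(2) level_const_measurable[OF u(1)] by (intro L1_norm_cmult) auto
  also have "\<dots> \<le> ennreal \<bar>c\<bar> * ennreal d" using u(2) by (rule mult_left_mono) simp
  also have "\<dots> \<le> ennreal e" using d by (auto simp: ennreal_mult[symmetric] intro: ennreal_leI)
  finally have "L1_norm (\<lambda>x. c * f x - c * u x) \<le> ennreal e" .
  moreover have "level_const n (\<lambda>x. c * u x)" using u(1) by (auto simp: level_const_def)
  ultimately show "\<exists>n g. level_const n g \<and> L1_norm (\<lambda>x. c * f x - g x) \<le> ennreal e" by blast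
qed

lemma approximable_closure:
  assumes f: "f \<in> borel_measurable haar"
    and *: "\<And>e. e > 0 \<Longrightarrow> \<exists>g. approximable g \<and> g \<in> borel_measurable haar
      \<and> L1_norm (\<lambda>x. f x - g x) \<le> ennreal e"
  shows "approximable f"
  unfolding approximable_def
proof (intro allI impI)
  fix e :: real assume "e > 0"
  then have e: "e / 2 > 0" by simp
  obtain g where g: "approximable g" "g \<in> borel_measurable haar"
      "L1_norm (\<lambda>x. f x - g x) \<le> ennreal (e / 2)"
    using *[OF e] by blast
  obtain n u where u: "level_const n u" "L1_norm (\<lambda>x. g x - u x) \<le> ennreal (e / 2)"
    using g(1) e unfolding approximable_def by blast
  have "L1_norm (\<lambda>x. (f x - g x) + (g x - u x))
      \<le> L1_norm (\<lambda>x. f x - g x) + L1_norm (\<lambda>x. g x - u x)"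
    using f g(2) level_const_measurable[OF u(1)] by (intro L1_norm_add) auto
  also have "\<dots> \<le> ennreal (e / 2) + ennreal (e / 2)" using u g by (intro add_mono)
  also have "\<dots> = ennreal e" using e by (subst ennreal_plus[symmetric]) auto
  finally show "\<exists>n h. level_const n h \<and> L1_norm (\<lambda>x. f x - h x) \<le> ennreal e"
    using u(1) by auto
qed

lemma approximable_sum:
  assumes "finite I" "\<And>i. i \<in> I \<Longrightarrow> approximable (f i) \<and> f i \<in> borel_measurable haar"
  shows "approximable (\<lambda>x. \<Sum>i\<in>I. f i x)"
  using assms
proof (induction I rule: finite_induct)
  case empty
  show ?case by (rule approximable_of_level_const[of 0]) (simp add: level_const_def)
next
  case (insert a I)
  then have "approximable (\<lambda>x. f a x + (\<Sum>i\<in>I. f i x))" 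
    by (intro approximable_add borel_measurable_sum) auto
  then show ?case using insert by simp
qed

lemma L1_norm_eq_integral: "integrable haar f \<Longrightarrow> L1_norm f = ennreal (LINT x|haar. \<bar>f x\<bar>)"
  unfolding L1_norm_def by (rule nn_integral_eq_integral) auto

text \<open>Closedness of the approximable functions, phrased with real integrals so that its
  hypothesis can be supplied by dominated convergence.\<close>

lemma approximable_lim:
  assumes f: "integrable haar f" and s: "\<And>i. integrable haar (s i)" "\<And>i. approximable (s i)"
    and lim: "(\<lambda>i. LINT x|haar. \<bar>f x - s i x\<bar>) \<longlonglongrightarrow> 0"
  shows "approximable f"
proof (rule approximable_closure)
  fix e :: real assume e: "e > 0"
  obtain i where "(LINT x|haar. \<bar>f x - s i x\<bar>) < e"
    using order_tendstoD(2)[OF lim e] by (auto simp: eventually_sequentially)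
  then have "L1_norm (\<lambda>x. f x - s i x) \<le> ennreal e"
    using f s by (subst L1_norm_eq_integral) (auto intro: ennreal_leI)
  then show "\<exists>g. approximable g \<and> g \<in> borel_measurable haar \<and> L1_norm (\<lambda>x. f x - g x) \<le> ennreal e"
    using s by blast
qed (use f in auto)

text \<open>Dynkin argument: the indicators of cosets are locally constant, cosets form an
  intersection-stable generator, and the sets with approximable indicator are closed under
  complements and countable disjoint unions.\<close>

lemma approximable_indicator:
  assumes "A \<in> sets haar" shows "approximable (indicator A)"
proof -
  have top: "approximable (\<lambda>_. c)" for c
    by (rule approximable_of_level_const[of 0]) (simp add: level_const_def)
  have "A \<in> sigma_sets Z2 coset2_gen" using assms by (simp add: sets_haar_gen)
  with Int_stable_coset2_gen coset2_gen_subset show ?thesis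
  proof (induction rule: sigma_sets_induct_disjoint)
    case (basic A)
    then show ?case
    proof (cases rule: coset2_gen_cases)
      case (2 j x)
      have "level_const j (indicator A :: q2 \<Rightarrow> real)"
        unfolding level_const_def 2(2) using coset2_eq coset2_refl by (metis indicator_simps)
      then show ?thesis by (rule approximable_of_level_const)
    qed (use top[of 0] in \<open>simp add: indicator_def\<close>)
  next
    case empty
    show ?case using top[of 0] by (simp add: indicator_def)
  next
    case (compl A)
    then have A: "A \<in> sets haar" by (simp add: sets_haar_gen)
    have "approximable (\<lambda>x. 1 + (-1) * indicator A x)"
      using A by (intro approximable_add approximable_cmult compl top) auto
    \<comment> \<open>The two functions differ outside \<open>Z2\<close>, which the seminorm does
      not see.\<close>
    moreover have "L1_norm (\<lambda>x. indicator (Z2 - A) x - g x) = L1_norm (\<lambda>x. 1 + (-1) * indicator A x - g x)" for g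
      by (rule L1_norm_cong) (auto simp: indicator_def)
    ultimately show ?case unfolding approximable_def by simp
  next
    case (union A)
    then have A: "\<And>i. A i \<in> sets haar" by (auto simp: sets_haar_gen)
    have m: "(\<Union>i. A i) \<in> sets haar" using A by auto
    \<comment> \<open>As a finite sum, \<open>s n\<close> is approximable; by disjointness it is
      also the indicator of a finite union, hence bounded by 1, and dominated convergence
      applies.\<close>
    define s where "s n = (\<lambda>x. \<Sum>i<n. indicator (A i) x :: real)" for n
    have s: "s n = indicator (\<Union>i<n. A i)" for n
      unfolding s_def using union(1)
      by (intro ext indicator_UN_disjoint[symmetric]) (auto simp: disjoint_family_on_def)
    show ?case
    proof (rule approximable_lim)
      show "approximable (s n)" for n
        unfolding s_def using A union(3) by (intro approximable_sum) auto
      show "(\<lambda>i. LINT x|haar. \<bar>indicator (\<Union>i. A i) x - s i x\<bar>) \<longlonglongrightarrow> 0"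
      proof -
        have "(\<lambda>n. LINT x|haar. \<bar>indicator (\<Union>i. A i) x - s n x\<bar>) \<longlonglongrightarrow> (LINT x|haar. 0 :: real)"
        proof (rule integral_dominated_convergence[where w = "\<lambda>_. 1"])
          show "AE x in haar. (\<lambda>n. \<bar>indicator (\<Union>i. A i) x - s n x\<bar>) \<longlonglongrightarrow> 0"
          proof (intro AE_I2 tendsto_rabs_zero)
            fix x
            have "(\<lambda>n. indicator (\<Union>i<n. A i) x :: real) \<longlonglongrightarrow> indicator (\<Union>i. A i) x"
              by (rule LIMSEQ_indicator_UN)
            from tendsto_diff[OF tendsto_const this, of "indicator (\<Union>i. A i) x"]
            show "(\<lambda>n. indicator (\<Union>i. A i) x - s n x) \<longlonglongrightarrow> 0"
              unfolding s by simp
          qed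
        qed (use m A in \<open>auto simp: s indicator_def\<close>)
        then show ?thesis by simp
      qed
    qed (use m A in \<open>auto simp: s haar.emeasure_eq_measure intro!: integrable_real_indicator\<close>)
  qed
qed

lemma approximable_integrable:
  assumes "integrable haar f" shows "approximable f"
  using assms
proof (induction rule: integrable_induct)
  case (base A c)
  then show ?case using approximable_cmult[OF approximable_indicator, of A c]
    by (simp add: mult.commute)
next
  case (add f g)
  then show ?case by (intro approximable_add) auto
next
  case (lim f s)
  show ?case
  proof (rule approximable_lim[OF lim(4,1,5)])
    have "(\<lambda>i. LINT x|haar. \<bar>f x - s i x\<bar>) \<longlonglongrightarrow> (LINT x|haar. 0 :: real)"
    \<comment> \<open>The induction rule supplies simple functions with absolute value at most
      \<open>2 * \<bar>f x\<bar>\<close>; the difference from \<open>f\<close> adds one more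
      \<open>\<bar>f x\<bar>\<close>.\<close>
    proof (rule integral_dominated_convergence[where w = "\<lambda>x. 3 * \<bar>f x\<bar>"])
      show "AE x in haar. (\<lambda>i. \<bar>f x - s i x\<bar>) \<longlonglongrightarrow> 0"
      proof (intro AE_I2 tendsto_rabs_zero)
        fix x assume "x \<in> space haar"
        from tendsto_diff[OF tendsto_const lim(2)[OF this], of "f x"]
        show "(\<lambda>i. f x - s i x) \<longlonglongrightarrow> 0" by simp
      qed
      show "AE x in haar. norm \<bar>f x - s i x\<bar> \<le> 3 * \<bar>f x\<bar>" for i
        using lim(3)[of _ i] by (intro AE_I2) fastforce
    qed (use lim in auto)
    then show "(\<lambda>i. LINT x|haar. \<bar>f x - s i x\<bar>) \<longlonglongrightarrow> 0" by simp
  qed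
qed

section \<open>Conditional expectations\<close>

lemma S2_eq: "x \<in> Z2 \<Longrightarrow> S2 j f x = 2 ^ j * (LINT y:coset2 j x|haar. f y)"
  by (simp add: S2_def measure_coset2)

text \<open>\<open>S2 j f x\<close> depends on \<open>x\<close> only through its coset, so this
  holds for every \<open>f\<close>. It also makes \<open>S2 j f\<close> invariant under translations
  of absolute value at most \<open>1 / 2 ^ j\<close>.\<close>

lemma level_const_S2: "level_const j (S2 j f)"
  unfolding level_const_def S2_def using coset2_eq by metis

lemma S2_measurable [measurable]: "S2 j f \<in> borel_measurable haar"
  by (rule level_const_measurable[OF level_const_S2])

lemma set_integrable_coset2:
  "integrable haar f \<Longrightarrow> x \<in> Z2 \<Longrightarrow> set_integrable haar (coset2 j x) (f :: q2 \<Rightarrow> real)"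
  unfolding set_integrable_def by (intro integrable_mult_indicator coset2_sets)

lemma S2_diff:
  assumes "integrable haar f" "integrable haar g" "x \<in> Z2"
  shows "S2 j (\<lambda>x. f x - g x) x = S2 j f x - S2 j g x"
  using assms(3) set_integral_diff(2)[OF set_integrable_coset2[OF assms(1,3)]
      set_integrable_coset2[OF assms(2,3)], of j]
  by (simp add: S2_eq right_diff_distrib)

lemma S2_level_const:
  assumes "level_const n g" "n \<le> j" "x \<in> Z2" shows "S2 j g x = g x"
proof -
  have "level_const j g" using assms level_const_mono by blast
  then have "(LINT y:coset2 j x|haar. g y) = (LINT y:coset2 j x|haar. g x)"
    using assms(3) by (intro set_lebesgue_integral_cong) (auto simp: level_const_def)
  also have "\<dots> = g x / 2 ^ j"
    using assms(3) by (simp add: set_lebesgue_integral_def measure_coset2 coset2_subset_Z2 Int_absorb2)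
  finally show ?thesis using assms(3) by (simp add: S2_eq)
qed

text \<open>Membership of \<open>z\<close> in the coset at \<open>x\<close> is membership of
  \<open>z + y\<close> in the coset at \<open>x + y\<close>, so the whole integrand is a translate
  and invariance of the measure applies.\<close>

lemma S2_translate:
  assumes f: "f \<in> borel_measurable haar" and xy: "x \<in> Z2" "y \<in> Z2"
  shows "S2 j (\<lambda>z. f (z + y)) x = S2 j f (x + y)"
proof -
  have xy': "x + y \<in> Z2" using xy by (rule Z2_add)
  have ind: "(indicator (coset2 j x) z :: real) = indicator (coset2 j (x + y)) (z + y)" for z
    by (auto simp: indicator_def coset2_iff)
  have "(LINT z:coset2 j x|haar. f (z + y))
      = (LINT z|haar. (\<lambda>z. indicator (coset2 j (x + y)) z *\<^sub>R f z) (z + y))"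
    unfolding set_lebesgue_integral_def ind ..
  also have "\<dots> = (LINT z|haar. indicator (coset2 j (x + y)) z *\<^sub>R f z)"
    using xy' f by (intro integral_translate xy) auto
  finally show ?thesis using xy xy' by (simp add: S2_eq set_lebesgue_integral_def)
qed

text \<open>On each coset the average is constant, and its absolute value times the measure of the
  coset is the absolute value of an integral, at most the integral of \<open>\<bar>f\<bar>\<close>
  there. Summing over the cosets gives the contraction.\<close>

lemma L1_norm_S2:
  assumes f: "integrable haar f" shows "L1_norm (S2 j f) \<le> L1_norm f"
proof -
  have [measurable]: "f \<in> borel_measurable haar" using f by auto
  have "L1_norm (S2 j f)
      = (\<Sum>i<2 ^ j. \<integral>\<^sup>+ x. ennreal \<bar>S2 j f x\<bar> * indicator (coset2 j (of_nat i)) x \<partial>haar)"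
    unfolding L1_norm_def by (rule nn_integral_cosets) auto
  also have "\<dots> \<le> (\<Sum>i<2 ^ j. \<integral>\<^sup>+ x. ennreal \<bar>f x\<bar> * indicator (coset2 j (of_nat i)) x \<partial>haar)"
  proof (rule sum_mono)
    fix i :: nat
    let ?C = "coset2 j (of_nat i)"
    have "(\<integral>\<^sup>+ x. ennreal \<bar>S2 j f x\<bar> * indicator ?C x \<partial>haar)
        = (\<integral>\<^sup>+ x. ennreal \<bar>S2 j f (of_nat i)\<bar> * indicator ?C x \<partial>haar)"
    proof (intro nn_integral_cong)
      fix x
      have "S2 j f x = S2 j f (of_nat i)" if "x \<in> ?C"
        using level_const_S2[of j f] Z2_of_nat[of i] that unfolding level_const_def by blast
      then show "ennreal \<bar>S2 j f x\<bar> * indicator ?C x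
          = ennreal \<bar>S2 j f (of_nat i)\<bar> * indicator ?C x"
        by (simp add: indicator_def)
    qed
    also have "\<dots> = ennreal \<bar>S2 j f (of_nat i)\<bar> * ennreal (1 / 2 ^ j)"
      by (simp add: nn_integral_cmult_indicator emeasure_coset2)
    also have "\<dots> = ennreal (norm (LINT y:?C|haar. f y))"
      by (simp add: S2_eq ennreal_mult[symmetric] abs_mult)
    also have "\<dots> \<le> (\<integral>\<^sup>+ y. ennreal (norm (indicator ?C y *\<^sub>R f y)) \<partial>haar)"
      unfolding set_lebesgue_integral_def
      by (intro integral_norm_bound_ennreal integrable_mult_indicator f) auto
    also have "\<dots> = (\<integral>\<^sup>+ x. ennreal \<bar>f x\<bar> * indicator ?C x \<partial>haar)"
      by (intro nn_integral_cong) (auto simp: indicator_def)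
    finally show "(\<integral>\<^sup>+ x. ennreal \<bar>S2 j f x\<bar> * indicator ?C x \<partial>haar)
        \<le> (\<integral>\<^sup>+ x. ennreal \<bar>f x\<bar> * indicator ?C x \<partial>haar)" .
  qed
  also have "\<dots> = L1_norm f"
    unfolding L1_norm_def by (rule nn_integral_cosets[symmetric]) auto
  finally show ?thesis .
qed

text \<open>If \<open>g\<close> is constant at level \<open>N\<close>, then \<open>S2 n\<close>
  fixes it for \<open>n \<ge> N\<close>, so the error for \<open>f\<close> equals the error for
  \<open>f - g\<close>; by contraction this costs at most twice the norm of
  \<open>f - g\<close>.\<close>

lemma S2_converges:
  assumes f: "integrable haar f" and e: "e > 0"
  obtains N where "\<And>n. n \<ge> N \<Longrightarrow> L1_norm (\<lambda>x. f x - S2 n f x) \<le> ennreal e"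
proof -
  have "e / 2 > 0" using e by simp
  then obtain N g where g: "level_const N g" "L1_norm (\<lambda>x. f x - g x) \<le> ennreal (e / 2)"
    using approximable_integrable[OF f] unfolding approximable_def by blast
  have gi: "integrable haar g" using level_const_integrable[OF g(1)] .
  have "L1_norm (\<lambda>x. f x - S2 n f x) \<le> ennreal e" if "n \<ge> N" for n
  proof -
    have "L1_norm (\<lambda>x. f x - S2 n f x)
        = L1_norm (\<lambda>x. (f x - g x) - S2 n (\<lambda>x. f x - g x) x)"
      using S2_level_const[OF g(1) that] by (intro L1_norm_cong) (simp add: S2_diff[OF f gi])
    also have "\<dots> \<le> L1_norm (\<lambda>x. f x - g x) + L1_norm (S2 n (\<lambda>x. f x - g x))"
      using f gi by (intro L1_norm_diff) auto
    also have "\<dots> \<le> ennreal (e / 2) + ennreal (e / 2)"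
      using f gi g by (intro add_mono order_trans[OF L1_norm_S2]) auto
    also have "\<dots> = ennreal e" using e by (subst ennreal_plus[symmetric]) auto
    finally show ?thesis .
  qed
  then show ?thesis using that by blast
qed

section \<open>Comparison of the norms\<close>

lemma coset2_split: "coset2 j x = coset2 (Suc j) x \<union> coset2 (Suc j) (x + 2 ^ j)"
proof (intro equalityI subsetI)
  fix z assume "z \<in> coset2 j x"
  then obtain w where w: "w \<in> Z2" "z = x + 2 ^ j * w" by (auto simp: coset2_def)
  \<comment> \<open>The residue of \<open>w\<close> modulo 2 decides which half contains
    \<open>z\<close>.\<close>
  obtain k where k: "k < 2 ^ 1" "w \<in> coset2 1 (of_nat k)" using Z2_approx[OF w(1)] .
  have "q2_abs (z - (x + 2 ^ j * of_nat k)) = 1 / 2 ^ j * q2_abs (w - of_nat k)"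
    unfolding q2_abs_power2[symmetric] q2_abs_mult[symmetric] w(2) by (simp add: algebra_simps)
  also have "\<dots> \<le> 1 / 2 ^ j * (1 / 2)"
    using k(2) by (intro mult_left_mono) (auto simp: coset2_iff)
  finally have "z \<in> coset2 (Suc j) (x + 2 ^ j * of_nat k)" by (simp add: coset2_iff)
  moreover have "k = 0 \<or> k = 1" using k(1) by auto
  ultimately show "z \<in> coset2 (Suc j) x \<union> coset2 (Suc j) (x + 2 ^ j)" by auto
next
  fix z assume "z \<in> coset2 (Suc j) x \<union> coset2 (Suc j) (x + 2 ^ j)"
  moreover have "x + 2 ^ j \<in> coset2 j x" by (simp add: coset2_iff q2_abs_power2)
  ultimately show "z \<in> coset2 j x"
    using coset2_mono[of j "Suc j"] coset2_refl[of x j] by auto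
qed

lemma coset2_split_disjoint: "coset2 (Suc j) x \<inter> coset2 (Suc j) (x + 2 ^ j) = {}"
proof (rule ccontr)
  assume "\<not> ?thesis"
  then have "x + 2 ^ j \<in> coset2 (Suc j) x" using coset2_eq coset2_refl by blast
  then show False by (simp add: coset2_iff q2_abs_power2 field_simps)
qed

lemma Z2_power2 [simp]: "2 ^ j \<in> Z2"
  by (simp add: Z2_def q2_abs_power2)

section \<open>The Besov norm bounded by the BV norm\<close>

lemma Delta2_eq:
  assumes f: "integrable haar f" and x: "x \<in> Z2"
  shows "Delta2 j f x = (S2 (Suc j) f x - S2 (Suc j) f (x + 2 ^ j)) / 2"
proof -
  have x': "x + 2 ^ j \<in> Z2" using x by (intro Z2_add) auto
  have "(LINT y:coset2 j x|haar. f y)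
      = (LINT y:coset2 (Suc j) x|haar. f y) + (LINT y:coset2 (Suc j) (x + 2 ^ j)|haar. f y)"
    unfolding coset2_split[of j x]
    by (intro set_integral_Un coset2_split_disjoint set_integrable_coset2 f x x')
  then show ?thesis using x x' by (simp add: Delta2_def S2_eq algebra_simps)
qed

lemma L1_norm_Delta2_le:
  assumes f: "integrable haar f"
  shows "L1_norm (Delta2 j f) \<le> L1_norm (\<lambda>x. f (x + 2 ^ j) - f x)"
proof -
  have t: "integrable haar (\<lambda>x. f (x + 2 ^ j))" using f by (intro integrable_translate) auto
  have "L1_norm (Delta2 j f) \<le> L1_norm (S2 (Suc j) (\<lambda>x. f (x + 2 ^ j) - f x))"
  proof (rule L1_norm_mono)
    fix x assume x: "x \<in> Z2"
    have "S2 (Suc j) (\<lambda>x. f (x + 2 ^ j) - f x) x = S2 (Suc j) f (x + 2 ^ j) - S2 (Suc j) f x"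
      using f x by (simp add: S2_diff[OF t f] S2_translate)
    \<comment> \<open>The factor 1/2 from \<open>Delta2_eq\<close> is given away here.\<close>
    then show "\<bar>Delta2 j f x\<bar> \<le> \<bar>S2 (Suc j) (\<lambda>x. f (x + 2 ^ j) - f x) x\<bar>"
      by (auto simp: Delta2_eq[OF f x] abs_if field_simps)
  qed
  also have "\<dots> \<le> L1_norm (\<lambda>x. f (x + 2 ^ j) - f x)"
    using f t by (intro L1_norm_S2) auto
  finally show ?thesis .
qed

text \<open>Testing the BV condition at \<open>y = 2 ^ j\<close>, whose absolute value is
  \<open>1 / 2 ^ j\<close>, cancels the weight \<open>2 ^ j\<close> exactly; hence the constant
  1.\<close>

lemma besov_norm_le_bound:
  assumes f: "integrable haar f" and C: "C \<in> BV_bounds f"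
  shows "besov_norm f \<le> ennreal C"
  unfolding besov_norm_def
proof (rule SUP_least)
  fix j
  have "L1_norm (Delta2 j f) \<le> ennreal (C * (1 / 2 ^ j))"
    using order_trans[OF L1_norm_Delta2_le[OF f]] C Z2_power2[of j]
    unfolding BV_bounds_def mem_Collect_eq q2_abs_power2[symmetric] by blast
  then have "ennreal (2 ^ j) * L1_norm (Delta2 j f) \<le> ennreal (2 ^ j) * ennreal (C * (1 / 2 ^ j))"
    by (rule mult_left_mono) simp
  also have "\<dots> = ennreal C" using C by (simp add: BV_bounds_def ennreal_mult[symmetric])
  finally show "2 ^ j * L1_norm (Delta2 j f) \<le> ennreal C" by (simp flip: ennreal_power)
qed

section \<open>The BV norm bounded by the Besov norm\<close>

lemma L1_norm_S2_diff_le: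
  assumes f: "integrable haar f" and b: "besov_norm f \<le> ennreal b" "b \<ge> 0"
  shows "L1_norm (\<lambda>x. S2 (j + n) f x - S2 j f x) \<le> ennreal (2 * b * (1 / 2 ^ j - 1 / 2 ^ (j + n)))"
\<comment> \<open>The difference telescopes into blocks of norm at most \<open>b / 2 ^ k\<close>.
  The bound is the exact value of their finite geometric sum, so the induction step is an equality
  of real numbers.\<close>
proof (induction n)
  case 0
  show ?case by (simp add: L1_norm_def)
next
  case (Suc n)
  have pos: "0 \<le> 1 / 2 ^ j - (1 / 2 ^ (j + n) :: real)" by (simp add: field_simps power_add)
  have d: "L1_norm (Delta2 k f) \<le> ennreal (b / 2 ^ k)" for k
  proof -
    have "2 ^ k * L1_norm (Delta2 k f) \<le> ennreal b"
      using b(1) unfolding besov_norm_def by (rule order_trans[OF SUP_upper, rotated]) simp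
    then have "ennreal (1 / 2 ^ k) * (ennreal (2 ^ k) * L1_norm (Delta2 k f)) \<le> ennreal (1 / 2 ^ k) * ennreal b"
      by (intro mult_left_mono) (auto simp: ennreal_power[symmetric])
    then show ?thesis
      using b(2) by (simp add: mult.assoc[symmetric] ennreal_mult[symmetric])
  qed
  have [measurable]: "Delta2 k f \<in> borel_measurable haar" for k
    unfolding Delta2_def by measurable
  have "L1_norm (\<lambda>x. S2 (j + Suc n) f x - S2 j f x)
      = L1_norm (\<lambda>x. Delta2 (j + n) f x + (S2 (j + n) f x - S2 j f x))"
    by (simp add: Delta2_def)
  also have "\<dots> \<le> L1_norm (Delta2 (j + n) f) + L1_norm (\<lambda>x. S2 (j + n) f x - S2 j f x)"
    by (rule L1_norm_add) auto
  also have "\<dots> \<le> ennreal (b / 2 ^ (j + n)) + ennreal (2 * b * (1 / 2 ^ j - 1 / 2 ^ (j + n)))"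
    by (intro add_mono d Suc)
  also have "\<dots> = ennreal (b / 2 ^ (j + n) + 2 * b * (1 / 2 ^ j - 1 / 2 ^ (j + n)))"
    using b(2) pos by (intro ennreal_plus[symmetric]) auto
  also have "b / 2 ^ (j + n) + 2 * b * (1 / 2 ^ j - 1 / 2 ^ (j + n)) = 2 * b * (1 / 2 ^ j - 1 / 2 ^ (j + Suc n))"
    by (simp add: field_simps)
  finally show ?case .
qed

text \<open>Passing through \<open>S2 (j + N) f\<close> with \<open>N\<close> large splits the error
  into an arbitrarily small part and a finite telescoping sum, bounded uniformly in
  \<open>N\<close>.\<close>

lemma L1_norm_minus_S2_le:
  assumes f: "integrable haar f" and b: "besov_norm f \<le> ennreal b" "b \<ge> 0"
  shows "L1_norm (\<lambda>x. f x - S2 j f x) \<le> ennreal (2 * b / 2 ^ j)"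
proof (rule ennreal_le_epsilon)
  fix e :: real assume e: "e > 0"
  obtain N where N: "\<And>n. n \<ge> N \<Longrightarrow> L1_norm (\<lambda>x. f x - S2 n f x) \<le> ennreal e"
    using S2_converges[OF f e] by blast
  have "L1_norm (\<lambda>x. (f x - S2 (j + N) f x) + (S2 (j + N) f x - S2 j f x))
      \<le> L1_norm (\<lambda>x. f x - S2 (j + N) f x) + L1_norm (\<lambda>x. S2 (j + N) f x - S2 j f x)"
    using f by (intro L1_norm_add) auto
  also have "\<dots> \<le> ennreal e + ennreal (2 * b * (1 / 2 ^ j - 1 / 2 ^ (j + N)))"
    by (intro add_mono N L1_norm_S2_diff_le f b) simp
  also have "\<dots> \<le> ennreal e + ennreal (2 * b / 2 ^ j)"
    using b(2) by (intro add_left_mono ennreal_leI) (simp add: field_simps)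
  finally show "L1_norm (\<lambda>x. f x - S2 j f x) \<le> ennreal (2 * b / 2 ^ j) + ennreal e"
    by (simp add: add.commute)
qed

text \<open>
  The value group of the absolute value consists of powers of 2, so the strict inequality could be
  sharpened to \<open>q2_abs y = 1 / 2 ^ j\<close>; the weaker form only costs a factor 2 in the final constant.
\<close>

lemma dyadic_shell:
  assumes "y \<in> Z2" "y \<noteq> 0"
  obtains j where "q2_abs y \<le> 1 / 2 ^ j" "1 / 2 ^ j < 2 * q2_abs y"
proof -
  have "q2_abs y > 0" using assms(2) by (metis q2_abs_eq_0 q2_abs_nonneg less_eq_real_def)
  then obtain n where "(1 / 2 :: real) ^ n < q2_abs y" using real_arch_pow_inv[of _ "1/2"] by auto
  then have n: "\<not> q2_abs y \<le> 1 / 2 ^ n" by (simp add: power_one_over)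
  \<comment> \<open>The first scale at which the bound fails is positive because
    \<open>\<bar>y\<bar> \<le> 1\<close> in the 2-adic sense; its predecessor is the required
    \<open>j\<close>.\<close>
  define m where "m = (LEAST n. \<not> q2_abs y \<le> 1 / 2 ^ n)"
  have m: "\<not> q2_abs y \<le> 1 / 2 ^ m" unfolding m_def using n by (rule LeastI)
  have "m \<noteq> 0" using m assms(1) by (auto simp: Z2_def intro: ccontr)
  then obtain j where j: "m = Suc j" using not0_implies_Suc by blast
  then have "q2_abs y \<le> 1 / 2 ^ j" 
    using not_less_Least[of j "\<lambda>n. \<not> q2_abs y \<le> 1 / 2 ^ n"] unfolding m_def by auto
  moreover have "1 / 2 ^ j < 2 * q2_abs y" using m j by (simp add: field_simps)
  ultimately show ?thesis by (rule that)
qed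

text \<open>The 8 is a product of three factors 2: from the two translates of
  \<open>f - S2 j f\<close>, from the geometric series, and from \<open>dyadic_shell\<close>.
  \<open>C\<close> is separate from \<open>8 * b\<close> because an admissible constant must be
  positive while \<open>b\<close> may be 0.\<close>

lemma BV_bounds_of_besov:
  assumes f: "integrable haar f" and b: "besov_norm f \<le> ennreal b" "b \<ge> 0"
    and C: "C > 0" "8 * b \<le> C"
  shows "C \<in> BV_bounds f"
  unfolding BV_bounds_def
proof (intro CollectI conjI ballI)
  fix y assume y: "y \<in> Z2"
  show "L1_norm (\<lambda>x. f (x + y) - f x) \<le> ennreal (C * q2_abs y)"
  proof (cases "y = 0")
    case False
    obtain j where j: "q2_abs y \<le> 1 / 2 ^ j" "1 / 2 ^ j < 2 * q2_abs y"
      using dyadic_shell[OF y False] .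
    let ?h = "\<lambda>x. f x - S2 j f x"
    have h: "?h \<in> borel_measurable haar" using f by auto
    have "L1_norm (\<lambda>x. f (x + y) - f x) = L1_norm (\<lambda>x. ?h (x + y) - ?h x)"
    proof (rule L1_norm_cong)
      fix x assume "x \<in> Z2"
      moreover have "x + y \<in> coset2 j x" using j(1) by (simp add: coset2_iff)
      ultimately have "S2 j f (x + y) = S2 j f x"
        using level_const_S2[of j f] by (simp add: level_const_def)
      then show "f (x + y) - f x = ?h (x + y) - ?h x" by simp
    qed
    also have "\<dots> \<le> L1_norm (\<lambda>x. ?h (x + y)) + L1_norm ?h"
      using measurable_comp_translate[OF y h] h by (rule L1_norm_diff)
    also have "\<dots> = L1_norm ?h + L1_norm ?h"
      using L1_norm_translate[OF y h] by simp
    also have "\<dots> \<le> ennreal (2 * b / 2 ^ j) + ennreal (2 * b / 2 ^ j)"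
      by (intro add_mono L1_norm_minus_S2_le f b)
    also have "\<dots> = ennreal (4 * b * (1 / 2 ^ j))"
      using b(2) by (subst ennreal_plus[symmetric]) auto
    also have "\<dots> \<le> ennreal (C * q2_abs y)"
    proof (rule ennreal_leI)
      have "4 * b * (1 / 2 ^ j) \<le> 4 * b * (2 * q2_abs y)"
        using j(2) b(2) by (intro mult_left_mono) auto
      also have "\<dots> \<le> C * q2_abs y" using mult_right_mono[OF C(2), of "q2_abs y"] by simp
      finally show "4 * b * (1 / 2 ^ j) \<le> C * q2_abs y" .
    qed
    finally show ?thesis .
  qed (simp add: L1_norm_def)
qed (rule C)

lemma BV_norm_le_besov_norm:
  assumes f: "integrable haar f" and fin: "besov_norm f < \<infinity>"
  shows "f \<in> BV" "BV_norm f \<le> ennreal 8 * besov_norm f"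
proof -
  obtain b where b: "b \<ge> 0" "besov_norm f = ennreal b"
    using fin by (cases "besov_norm f") auto
  \<comment> \<open>Adding \<open>e > 0\<close> ensures positivity when \<open>b = 0\<close>; the
    infimum over all such constants removes it again.\<close>
  have bound: "8 * b + e \<in> BV_bounds f" if "e > 0" for e
    using b that by (intro BV_bounds_of_besov[OF f, of b]) auto
  then show "f \<in> BV" unfolding BV_def using bound[OF zero_less_one] by blast
  show "BV_norm f \<le> ennreal 8 * besov_norm f"
  proof (rule ennreal_le_epsilon)
    fix e :: real assume e: "e > 0"
    have "BV_norm f \<le> ennreal (8 * b + e)"
      unfolding BV_norm_def by (rule INF_lower[OF bound[OF e]])
    also have "\<dots> = ennreal 8 * besov_norm f + ennreal e"
      using b e by (simp add: ennreal_mult del: ennreal_numeral)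
    finally show "BV_norm f \<le> ennreal 8 * besov_norm f + ennreal e" .
  qed
qed

theorem theorem1:
  shows "(\<forall>f. integrable haar f \<longrightarrow> (f \<in> BV \<longleftrightarrow> f \<in> besov)) \<and>
    (\<exists>C1 C2 :: real. C1 > 0 \<and> C2 > 0 \<and>
      (\<forall>f. integrable haar f \<and> f \<in> BV \<longrightarrow>
        ennreal C1 * besov_norm f \<le> BV_norm f \<and>
        BV_norm f \<le> ennreal C2 * besov_norm f))"
proof -
  have besov: "f \<in> besov" if f: "integrable haar f" "f \<in> BV" for f
  proof -
    obtain C where "C \<in> BV_bounds f" using f(2) by (auto simp: BV_def)
    then have "besov_norm f \<le> ennreal C" by (rule besov_norm_le_bound[OF f(1)])
    also have "\<dots> < \<infinity>" by simp
    finally show ?thesis by (simp add: besov_def)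
  qed
  \<comment> \<open>This also covers \<open>f\<close> outside \<open>BV\<close>, where the infimum
    over the empty set is infinite.\<close>
  have lower: "besov_norm f \<le> BV_norm f" if "integrable haar f" for f
    unfolding BV_norm_def using besov_norm_le_bound[OF that] by (rule INF_greatest)
  have "f \<in> BV \<longleftrightarrow> f \<in> besov" if "integrable haar f" for f
    using that besov BV_norm_le_besov_norm(1) by (auto simp: besov_def)
  moreover have "ennreal 1 * besov_norm f \<le> BV_norm f \<and> BV_norm f \<le> ennreal 8 * besov_norm f"
    if "integrable haar f \<and> f \<in> BV" for f
    using that lower besov BV_norm_le_besov_norm(2) by (auto simp: besov_def)
  ultimately show ?thesis using zero_less_one zero_less_numeral by blast
qed

end
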